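(* a) There exists a martingale $f\in H_{1/2}$ such that $$\sup_{n\in\mathbb N_+}\|\sigma_nf\|_{1/2}=+\infty .$$ b) Let $0<p<1/2$. There exists a martingale $f\in H_p$ such that $$\sup_{n\in\mathbb N_+}\|\sigma_nf\|_{weak-L_p}=+\infty .$$
   Context: $\mathbb N_+$ is the set of positive integers, $\mathbb N=\mathbb N_+\cup\{0\}$. Fix a bounded sequence $m=(m_0,m_1,\dots)$ of integers $m_k\ge 2$. $G_m=\prod_{k\ge0}Z_{m_k}$, where $Z_{m_k}=\{0,\dots,m_k-1\}$ is the additive group modulo $m_k$, with the product of the discrete topologies; $\mu$ is the Haar measure with $\mu(G_m)=1$. $M_0:=1$, $M_{k+1}:=m_kM_k$; every $n\in\mathbb N$ is uniquely $n=\sum_{j\ge0}n_jM_j$ with $n_j\in Z_{m_j}$. $r_k(x):=\exp(2\pi i x_k/m_k)$, $\psi_n:=\prod_{k\ge0}r_k^{n_k}$ (Vilenkin system). $I_0(x):=G_m$, $I_n(x):=\{y: y_0=x_0,\dots,y_{n-1}=x_{n-1}\}$; $\mathcal F_n$ is the $\sigma$-algebra generated by $\{I_n(x):x\in G_m\}$. For $g\in L_1(G_m)$: $\widehat g(k):=\int g\overline{\psi_k}\,d\mu$, $S_ng:=\sum_{k=0}^{n-1}\widehat g(k)\psi_k$. A martingale is a sequence $f=(f^{(n)}:n\in\mathbb N)$ of integrable functions with $f^{(n)}$ $\mathcal F_n$-measurable and $S_{M_n}f^{(k)}=f^{(n)}$ for $n\le k$; $f^*:=\sup_n|f^{(n)}|$;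 $H_p$ is the set of martingales with $\|f\|_{H_p}:=\|f^*\|_p<\infty$, where $\|g\|_p:=(\int|g|^pd\mu)^{1/p}$. For a martingale, $\widehat f(i):=\lim_k\int f^{(k)}\overline{\psi_i}\,d\mu$, $S_nf:=\sum_{k=0}^{n-1}\widehat f(k)\psi_k$, and the Fejér means are $\sigma_nf:=\frac1n\sum_{k=1}^nS_kf$ ($n\in\mathbb N_+$). $\|g\|_{weak-L_p}:=\sup_{\lambda>0}\lambda\,\mu(|g|>\lambda)^{1/p}$. *)

theory Defs
  imports "HOL-Probability.Probability" "HOL-Algebra.Product_Groups"
begin

section \<open>The Vilenkin group and its Haar measure\<close>

definition vilenkin_group :: "(nat \<Rightarrow> nat) \<Rightarrow> (nat \<Rightarrow> int) monoid" where
  "vilenkin_group m = product_group UNIV (\<lambda>k. integer_mod_group (m k))"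

definition vilenkin_topology :: "(nat \<Rightarrow> nat) \<Rightarrow> (nat \<Rightarrow> int) topology" where
  "vilenkin_topology m =
     product_topology (\<lambda>k. discrete_topology (carrier (integer_mod_group (m k)))) UNIV"

text \<open>On a second countable compact group every finite Borel measure is regular, so regularity
  need not be demanded separately.\<close>

definition normalized_haar :: "'a monoid \<Rightarrow> 'a topology \<Rightarrow> 'a measure \<Rightarrow> bool" where
  "normalized_haar G T \<mu> \<longleftrightarrow>
     space \<mu> = carrier G \<and>
     sets \<mu> = sigma_sets (carrier G) {U. openin T U} \<and>
     emeasure \<mu> (carrier G) = 1 \<and>
     (\<forall>a\<in>carrier G. \<forall>A\<in>sets \<mu>. emeasure \<mu> ((\<lambda>x. a \<otimes>\<^bsub>G\<^esub> x) ` A) = emeasure \<mu> A)"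

section \<open>The Vilenkin system\<close>

definition M_seq :: "(nat \<Rightarrow> nat) \<Rightarrow> nat \<Rightarrow> nat" where
  "M_seq m k = (\<Prod>j<k. m j)"

definition digit :: "(nat \<Rightarrow> nat) \<Rightarrow> nat \<Rightarrow> nat \<Rightarrow> nat" where
  "digit m n j = (n div M_seq m j) mod m j"

definition rademacher :: "(nat \<Rightarrow> nat) \<Rightarrow> nat \<Rightarrow> (nat \<Rightarrow> int) \<Rightarrow> complex" where
  "rademacher m k x = exp (2 * of_real pi * \<i> * of_int (x k) / of_nat (m k))"

definition vilenkin :: "(nat \<Rightarrow> nat) \<Rightarrow> nat \<Rightarrow> (nat \<Rightarrow> int) \<Rightarrow> complex" where
  "vilenkin m n x = (\<Prod>k. rademacher m k x ^ digit m n k)"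

section \<open>Fourier coefficients, martingales and Hardy spaces\<close>

definition cylinder :: "(nat \<Rightarrow> nat) \<Rightarrow> nat \<Rightarrow> (nat \<Rightarrow> int) \<Rightarrow> (nat \<Rightarrow> int) set" where
  "cylinder m n x = {y \<in> carrier (vilenkin_group m). \<forall>j<n. y j = x j}"

definition filtration :: "(nat \<Rightarrow> nat) \<Rightarrow> nat \<Rightarrow> (nat \<Rightarrow> int) measure" where
  "filtration m n =
     sigma (carrier (vilenkin_group m)) (cylinder m n ` carrier (vilenkin_group m))"

definition fourier_coeff ::
    "(nat \<Rightarrow> nat) \<Rightarrow> (nat \<Rightarrow> int) measure \<Rightarrow> ((nat \<Rightarrow> int) \<Rightarrow> complex) \<Rightarrow> nat \<Rightarrow> complex" where
  "fourier_coeff m \<mu> g k = (LINT x|\<mu>. g x * cnj (vilenkin m k x))"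

definition partial_sum ::
    "(nat \<Rightarrow> nat) \<Rightarrow> (nat \<Rightarrow> int) measure \<Rightarrow> nat \<Rightarrow> ((nat \<Rightarrow> int) \<Rightarrow> complex)
      \<Rightarrow> (nat \<Rightarrow> int) \<Rightarrow> complex" where
  "partial_sum m \<mu> n g x = (\<Sum>k<n. fourier_coeff m \<mu> g k * vilenkin m k x)"

text \<open>The martingale identity is required pointwise on the group. This agrees with equality almost
  everywhere, because both sides are constant on the cylinders of rank \<open>n\<close>, which have positive
  measure.\<close>

definition vilenkin_martingale ::
    "(nat \<Rightarrow> nat) \<Rightarrow> (nat \<Rightarrow> int) measure \<Rightarrow> (nat \<Rightarrow> (nat \<Rightarrow> int) \<Rightarrow> complex) \<Rightarrow> bool" where
  "vilenkin_martingale m \<mu> f \<longleftrightarrow>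
     (\<forall>n. integrable \<mu> (f n)) \<and>
     (\<forall>n. f n \<in> borel_measurable (filtration m n)) \<and>
     (\<forall>n k. n \<le> k \<longrightarrow>
        (\<forall>x\<in>carrier (vilenkin_group m). partial_sum m \<mu> (M_seq m n) (f k) x = f n x))"

text \<open>Powers of extended nonnegative reals, used for positive exponents only.\<close>

definition ennreal_powr :: "ennreal \<Rightarrow> real \<Rightarrow> ennreal" where
  "ennreal_powr x p = (if x = \<top> then \<top> else ennreal (enn2real x powr p))"

definition Lp_quasinorm :: "'a measure \<Rightarrow> real \<Rightarrow> ('a \<Rightarrow> ennreal) \<Rightarrow> ennreal" where
  "Lp_quasinorm \<mu> p g = ennreal_powr (\<integral>\<^sup>+ x. ennreal_powr (g x) p \<partial>\<mu>) (1 / p)"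

definition weak_Lp_quasinorm :: "'a measure \<Rightarrow> real \<Rightarrow> ('a \<Rightarrow> ennreal) \<Rightarrow> ennreal" where
  "weak_Lp_quasinorm \<mu> p g =
     (SUP t\<in>{0<..}. ennreal t * ennreal_powr (emeasure \<mu> {x \<in> space \<mu>. g x > ennreal t}) (1 / p))"

definition maximal_function :: "(nat \<Rightarrow> 'a \<Rightarrow> complex) \<Rightarrow> 'a \<Rightarrow> ennreal" where
  "maximal_function f x = (SUP n. ennreal (norm (f n x)))"

definition hardy_space ::
    "(nat \<Rightarrow> nat) \<Rightarrow> (nat \<Rightarrow> int) measure \<Rightarrow> real \<Rightarrow> (nat \<Rightarrow> (nat \<Rightarrow> int) \<Rightarrow> complex) set" where
  "hardy_space m \<mu> p =
     {f. vilenkin_martingale m \<mu> f \<and> Lp_quasinorm \<mu> p (maximal_function f) < \<top>}"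

section \<open>Fejer means of martingales\<close>

definition mart_fourier_coeff ::
    "(nat \<Rightarrow> nat) \<Rightarrow> (nat \<Rightarrow> int) measure \<Rightarrow> (nat \<Rightarrow> (nat \<Rightarrow> int) \<Rightarrow> complex) \<Rightarrow> nat \<Rightarrow> complex" where
  "mart_fourier_coeff m \<mu> f i = lim (\<lambda>k. fourier_coeff m \<mu> (f k) i)"

definition mart_partial_sum ::
    "(nat \<Rightarrow> nat) \<Rightarrow> (nat \<Rightarrow> int) measure \<Rightarrow> nat \<Rightarrow> (nat \<Rightarrow> (nat \<Rightarrow> int) \<Rightarrow> complex)
      \<Rightarrow> (nat \<Rightarrow> int) \<Rightarrow> complex" where
  "mart_partial_sum m \<mu> n f x = (\<Sum>k<n. mart_fourier_coeff m \<mu> f k * vilenkin m k x)"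

definition fejer_mean ::
    "(nat \<Rightarrow> nat) \<Rightarrow> (nat \<Rightarrow> int) measure \<Rightarrow> nat \<Rightarrow> (nat \<Rightarrow> (nat \<Rightarrow> int) \<Rightarrow> complex)
      \<Rightarrow> (nat \<Rightarrow> int) \<Rightarrow> complex" where
  "fejer_mean m \<mu> n f x = (\<Sum>k=1..n. mart_partial_sum m \<mu> k f x) / of_nat n"

section \<open>Consistency of the definitions\<close>

lemma M_seq_rec: "M_seq m 0 = 1" "M_seq m (Suc k) = m k * M_seq m k"
  by (simp_all add: M_seq_def mult.commute)

lemma digit_partial: "(\<Sum>j<k. digit m n j * M_seq m j) = n mod M_seq m k"
proof (induction k)
  case (Suc k)
  have "n mod (M_seq m k * m k) = M_seq m k * (n div M_seq m k mod m k) + n mod M_seq m k"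
    by (rule mod_mult2_eq)
  then show ?case using Suc by (simp add: digit_def M_seq_rec mult.commute)
qed (simp add: M_seq_rec)

lemma M_seq_ge:
  assumes "\<And>k. 2 \<le> m k" shows "k < M_seq m k"
proof (induction k)
  case (Suc k)
  have "Suc k < 2 * M_seq m k" using Suc by linarith
  also have "\<dots> \<le> m k * M_seq m k" using assms[of k] by (rule mult_le_mono1)
  finally show ?case by (simp add: M_seq_rec)
qed (simp add: M_seq_rec)

lemma digit_eq_0:
  assumes "\<And>k. 2 \<le> m k" "n \<le> j" shows "digit m n j = 0"
  using M_seq_ge[of m j, OF assms(1)] assms(2) by (simp add: digit_def)

text \<open>The digits are the coefficients of the expansion in the base \<open>M_seq m\<close>, and that expansion is
  unique.\<close>

lemma digit_expansion:
  assumes m: "\<And>k. 2 \<le> m k"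
  shows "digit m n j < m j" "finite {j. digit m n j \<noteq> 0}"
    and "n = (\<Sum>j | digit m n j \<noteq> 0. digit m n j * M_seq m j)"
proof -
  show "digit m n j < m j"
    using m[of j] by (simp add: digit_def)
  have sub: "{j. digit m n j \<noteq> 0} \<subseteq> {..<n}"
    using digit_eq_0[of m, OF m] by (metis (mono_tags, lifting) lessThan_iff mem_Collect_eq not_le subsetI)
  then show "finite {j. digit m n j \<noteq> 0}"
    by (rule finite_subset) simp
  have "n = n mod M_seq m n"
    using M_seq_ge[of m n, OF m] by simp
  also have "\<dots> = (\<Sum>j<n. digit m n j * M_seq m j)"
    by (rule digit_partial[symmetric])
  also have "\<dots> = (\<Sum>j | digit m n j \<noteq> 0. digit m n j * M_seq m j)"
    using sub by (intro sum.mono_neutral_right) auto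
  finally show "n = (\<Sum>j | digit m n j \<noteq> 0. digit m n j * M_seq m j)" .
qed

lemma digit_unique:
  assumes m: "\<And>k. 2 \<le> m k"
    and d: "\<And>j. d j < m j" "finite {j. d j \<noteq> 0}"
    and n: "n = (\<Sum>j | d j \<noteq> 0. d j * M_seq m j)"
  shows "d j = digit m n j"
proof -
  have less: "(\<Sum>i<k. d i * M_seq m i) < M_seq m k" for k
  proof (induction k)
    case (Suc k)
    have "(\<Sum>i<Suc k. d i * M_seq m i) < (d k + 1) * M_seq m k"
      using Suc by simp
    also have "\<dots> \<le> m k * M_seq m k"
      using d(1)[of k] by (intro mult_le_mono1) simp
    finally show ?case by (simp add: M_seq_rec)
  qed (simp add: M_seq_rec)
  have dvd: "k \<le> i \<Longrightarrow> M_seq m k dvd M_seq m i" for k i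
    by (induction i rule: dec_induct) (auto simp: M_seq_rec)
  obtain N where N: "{j. d j \<noteq> 0} \<subseteq> {..<N}" and jN: "Suc j \<le> N"
  proof -
    obtain N0 where "{j. d j \<noteq> 0} \<subseteq> {..<N0}"
      using d(2) finite_nat_bounded by blast
    then show thesis by (intro that[of "max N0 (Suc j)"]) auto
  qed
  have nN: "n = (\<Sum>i<N. d i * M_seq m i)"
    unfolding n using N by (intro sum.mono_neutral_left) auto
  have md: "n mod M_seq m k = (\<Sum>i<k. d i * M_seq m i)" if "k \<le> N" for k
  proof -
    have "{..<N} = {..<k} \<union> {k..<N}" using that by auto
    then have "n = (\<Sum>i<k. d i * M_seq m i) + (\<Sum>i=k..<N. d i * M_seq m i)"
      unfolding nN by (simp add: sum.union_disjoint ivl_disj_int)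
    moreover obtain c where "(\<Sum>i=k..<N. d i * M_seq m i) = M_seq m k * c"
    proof -
      have "M_seq m k dvd (\<Sum>i=k..<N. d i * M_seq m i)"
        using dvd by (intro dvd_sum) auto
      then show thesis by (auto intro: that elim: dvdE)
    qed
    ultimately have "n = M_seq m k * c + (\<Sum>i<k. d i * M_seq m i)" by linarith
    then show ?thesis using less[of k] by (metis mod_less mod_mult_self4)
  qed
  have "d j * M_seq m j = digit m n j * M_seq m j"
    using md[of j] md[of "Suc j"] digit_partial[of m n j] digit_partial[of m n "Suc j"] jN
    unfolding sum.lessThan_Suc by linarith
  moreover have "M_seq m j > 0" using M_seq_ge[of m j, OF m] by linarith
  ultimately show ?thesis by simp
qed

text \<open>The product of the uniform distributions is a normalized Haar measure.\<close>

lemma carrier_vilenkin_group: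
  assumes "\<And>k. 2 \<le> m k"
  shows "carrier (vilenkin_group m) = (\<Pi>\<^sub>E k\<in>UNIV. {0..<int (m k)})"
proof -
  have "(m k = 0) = False" for k using assms[of k] by auto
  then show ?thesis by (simp only: vilenkin_group_def carrier_product_group carrier_integer_mod_group if_False)
qed

lemma sets_PiM_vilenkin:
  assumes m: "\<And>k. 2 \<le> m k"
  shows "sets (\<Pi>\<^sub>M k\<in>UNIV. uniform_count_measure {0..<int (m k)}) =
    sigma_sets (carrier (vilenkin_group m)) {U. openin (vilenkin_topology m) U}"
proof -
  let ?C = "carrier (vilenkin_group m)"
  let ?Z = "\<lambda>k. {0..<int (m k)}"
  let ?P = "\<Pi>\<^sub>M k\<in>UNIV. uniform_count_measure (?Z k)"
  have C: "?C = (\<Pi>\<^sub>E k\<in>UNIV. ?Z k)" by (rule carrier_vilenkin_group[OF m])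
  have mnz: "m k \<noteq> 0" for k using m[of k] by linarith
  have T: "vilenkin_topology m = product_topology (\<lambda>k. discrete_topology (?Z k)) UNIV"
    by (simp add: vilenkin_topology_def carrier_integer_mod_group mnz)
  have spP: "space ?P = ?C"
    by (simp add: space_PiM C space_uniform_count_measure)
  have gen: "sets ?P = sigma_sets ?C {{f\<in>?C. f i \<in> A} | i A. A \<in> Pow (?Z i)}"
    by (simp add: sets_PiM_single C space_uniform_count_measure sets_uniform_count_measure)
  have opn: "openin (vilenkin_topology m) {f\<in>?C. f i \<in> A}" if "A \<subseteq> ?Z i" for i A
  proof -
    have "{f\<in>?C. f i \<in> A} = (\<Pi>\<^sub>E k\<in>UNIV. if k = i then A else ?Z k)"
      using that by (auto simp: C PiE_iff split: if_splits) (metis atLeastLessThan_iff subsetD)+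
    moreover have "finite {k. (if k = i then A else ?Z k) \<noteq> ?Z k}"
      by (rule finite_subset[of _ "{i}"]) auto
    ultimately show ?thesis
      unfolding T using that by (simp add: openin_PiE_gen)
  qed
  have cyl: "cylinder m n x \<in> sets ?P" for n x
  proof -
    have "cylinder m n x = {f\<in>space ?P. \<forall>j<n. f j \<in> {x j} \<inter> ?Z j}"
      unfolding spP by (auto simp: cylinder_def C PiE_iff)
    also have "\<dots> = {f\<in>space ?P. \<forall>j\<in>{..<n}. f j \<in> {x j} \<inter> ?Z j}"
      by auto
    also have "\<dots> \<in> sets ?P"
    proof (rule sets.sets_Collect_finite_All)
      fix j
      have "{x j} \<inter> ?Z j \<in> sets (uniform_count_measure (?Z j))"
        by (simp add: sets_uniform_count_measure)
      then have "(\<lambda>f. f j) -` ({x j} \<inter> ?Z j) \<inter> space ?P \<in> sets ?P"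
        by (intro measurable_sets[OF measurable_component_singleton]) auto
      also have "(\<lambda>f. f j) -` ({x j} \<inter> ?Z j) \<inter> space ?P = {f\<in>space ?P. f j \<in> {x j} \<inter> ?Z j}"
        by auto
      finally show "{f\<in>space ?P. f j \<in> {x j} \<inter> ?Z j} \<in> sets ?P" .
    qed simp
    finally show ?thesis .
  qed
  have cnt: "countable (range (\<lambda>(n, x). cylinder m n x))"
  proof (rule countable_subset)
    let ?f = "\<lambda>l. {y \<in> ?C. \<forall>j<length l. y j = l ! j}"
    show "range (\<lambda>(n, x). cylinder m n x) \<subseteq> range ?f"
    proof clarify
      fix n and x :: "nat \<Rightarrow> int"
      have "cylinder m n x = ?f (map x [0..<n])" by (auto simp: cylinder_def)
      then show "cylinder m n x \<in> range ?f" by blast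
    qed
  qed auto
  have U: "U \<in> sets ?P" if oU: "openin (vilenkin_topology m) U" for U
  proof -
    let ?K = "{K \<in> range (\<lambda>(n, x). cylinder m n x). K \<subseteq> U}"
    have "U \<subseteq> \<Union>?K"
    proof
      fix x assume x: "x \<in> U"
      obtain V where V: "finite {i. V i \<noteq> ?Z i}" "x \<in> Pi\<^sub>E UNIV V" "Pi\<^sub>E UNIV V \<subseteq> U"
        using iffD1[OF openin_product_topology_alt oU[unfolded T]] x by auto
      obtain n where n: "{i. V i \<noteq> ?Z i} \<subseteq> {..<n}"
        using V(1) finite_nat_bounded by blast
      have "cylinder m n x \<subseteq> Pi\<^sub>E UNIV V"
      proof
        fix y assume y: "y \<in> cylinder m n x"
        have "y i \<in> V i" for i
        proof (cases "i < n")
          case True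
          then show ?thesis using y V(2) by (auto simp: cylinder_def PiE_iff)
        next
          case False
          then have "V i = ?Z i" using n by auto
          then show ?thesis using y by (auto simp: cylinder_def C PiE_iff)
        qed
        then show "y \<in> Pi\<^sub>E UNIV V" by auto
      qed
      then have "cylinder m n x \<in> ?K" using V(3) by auto
      moreover have "x \<in> ?C"
        using openin_subset[OF oU] x by (auto simp: T C)
      then have "x \<in> cylinder m n x" by (simp add: cylinder_def)
      ultimately show "x \<in> \<Union>?K" by (rule UnionI)
    qed
    then have "U = \<Union>?K" by blast
    moreover have "\<Union>?K \<in> sets ?P"
    proof (rule sets.countable_Union)
      show "countable ?K" by (rule countable_subset[OF _ cnt]) auto
      show "?K \<subseteq> sets ?P" using cyl by auto
    qed
    ultimately show ?thesis by simp
  qed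
  show ?thesis
  proof
    show "sets ?P \<subseteq> sigma_sets ?C {U. openin (vilenkin_topology m) U}"
      unfolding gen using opn by (intro sigma_sets_mono') auto
    show "sigma_sets ?C {U. openin (vilenkin_topology m) U} \<subseteq> sets ?P"
      using U sets.sigma_sets_subset[of "{U. openin (vilenkin_topology m) U}" ?P]
      by (auto simp: spP)
  qed
qed

lemma normalized_haar_exists:
  assumes m: "\<And>k. 2 \<le> m k"
  shows "normalized_haar (vilenkin_group m) (vilenkin_topology m)
    (\<Pi>\<^sub>M k\<in>UNIV. uniform_count_measure {0..<int (m k)})"
proof -
  let ?C = "carrier (vilenkin_group m)"
  let ?Z = "\<lambda>k. {0..<int (m k)}"
  let ?u = "\<lambda>k. uniform_count_measure (?Z k)"
  let ?P = "\<Pi>\<^sub>M k\<in>UNIV. ?u k"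
  let ?t = "\<lambda>a x. a \<otimes>\<^bsub>vilenkin_group m\<^esub> x"
  have C: "?C = (\<Pi>\<^sub>E k\<in>UNIV. ?Z k)" by (rule carrier_vilenkin_group[OF m])
  have mpos: "m k > 0" for k using m[of k] by linarith
  have spP: "space ?P = ?C"
    by (simp add: space_PiM C space_uniform_count_measure)
  have pr: "prob_space (?u k)" for k
    using mpos[of k] by (intro prob_space_uniform_count_measure) auto
  interpret P: product_prob_space ?u UNIV
    using pr by (simp add: product_prob_space_def product_prob_space_axioms_def
      product_sigma_finite_def prob_space_imp_sigma_finite)
  have tr: "?t a x = (\<lambda>k. (a k + x k) mod int (m k))" for a x
    by (simp add: vilenkin_group_def restrict_def)
  interpret G: group "vilenkin_group m"
    unfolding vilenkin_group_def by simp
  have sn: "{x\<in>?Z k. (b + x) mod int (m k) \<in> A} = (\<lambda>y. (y - b) mod int (m k)) ` A"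
    and inj: "inj_on (\<lambda>y. (y - b) mod int (m k)) A" if "A \<subseteq> ?Z k" for k b A
  proof -
    have l: "(b + (y - b) mod int (m k)) mod int (m k) = y" if "y \<in> A" for y
      using that \<open>A \<subseteq> ?Z k\<close> by (auto simp: mod_simps)
    then show "inj_on (\<lambda>y. (y - b) mod int (m k)) A" by (metis (no_types, lifting) inj_onI)
    have r: "((b + x) mod int (m k) - b) mod int (m k) = x" if "x \<in> ?Z k" for x
      using that by (auto simp: mod_simps)
    have "x \<in> (\<lambda>y. (y - b) mod int (m k)) ` A"
      if "x \<in> ?Z k" "(b + x) mod int (m k) \<in> A" for x
      using r[OF that(1)] that(2) by (metis image_eqI)
    moreover have "(y - b) mod int (m k) \<in> {x\<in>?Z k. (b + x) mod int (m k) \<in> A}" if "y \<in> A" for y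
      using l[OF that] that mpos[of k] by simp
    ultimately show "{x\<in>?Z k. (b + x) mod int (m k) \<in> A} = (\<lambda>y. (y - b) mod int (m k)) ` A"
      by blast
  qed
  have inv: "emeasure (?u k) {x\<in>?Z k. (b + x) mod int (m k) \<in> A} = emeasure (?u k) A"
    if A: "A \<subseteq> ?Z k" for k b A
  proof -
    have "card {x\<in>?Z k. (b + x) mod int (m k) \<in> A} = card A"
      unfolding sn[OF A] by (rule card_image[OF inj[OF A]])
    moreover have "{x\<in>?Z k. (b + x) mod int (m k) \<in> A} \<subseteq> ?Z k" by auto
    ultimately show ?thesis using A by (simp add: emeasure_uniform_count_measure)
  qed
  have tm: "?t a \<in> ?P \<rightarrow>\<^sub>M ?P" for a
  proof (rule measurable_PiM_single')
    fix k
    have "(\<lambda>y. (a k + y) mod int (m k)) \<in> ?u k \<rightarrow>\<^sub>M ?u k"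
      using mpos[of k]
      by (auto simp: measurable_def space_uniform_count_measure sets_uniform_count_measure)
    then show "(\<lambda>x. ?t a x k) \<in> ?P \<rightarrow>\<^sub>M ?u k"
      unfolding tr by (rule measurable_compose[rotated]) (rule measurable_component_singleton, simp)
  next
    show "?t a \<in> space ?P \<rightarrow> (\<Pi>\<^sub>E k\<in>UNIV. space (?u k))"
      using mpos by (auto simp: tr space_uniform_count_measure)
  qed
  have ds: "distr ?P ?P (?t a) = ?P" for a
  proof (rule P.PiM_eq)
    fix J F assume J: "finite J" "J \<subseteq> UNIV" and F: "\<And>j. j \<in> J \<Longrightarrow> F j \<in> sets (?u j)"
    have F': "F j \<subseteq> ?Z j" if "j \<in> J" for j
      using F[OF that] by (simp add: sets_uniform_count_measure)
    let ?F' = "\<lambda>j. {x\<in>?Z j. (a j + x) mod int (m j) \<in> F j}"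
    let ?E = "prod_emb UNIV ?u J (Pi\<^sub>E J F)"
    have "emeasure (distr ?P ?P (?t a)) ?E = emeasure ?P (?t a -` ?E \<inter> space ?P)"
      using J F by (intro emeasure_distr tm sets_PiM_I) auto
    also have "?t a -` ?E \<inter> space ?P = prod_emb UNIV ?u J (Pi\<^sub>E J ?F')"
    proof -
      have "x \<in> ?t a -` ?E \<inter> space ?P \<longleftrightarrow> x \<in> prod_emb UNIV ?u J (Pi\<^sub>E J ?F')" for x
        using mpos unfolding spP C
        by (simp add: tr prod_emb_def PiE_iff space_uniform_count_measure) blast
      then show ?thesis by blast
    qed
    also have "emeasure ?P \<dots> = (\<Prod>j\<in>J. emeasure (?u j) (?F' j))"
      using J by (intro P.emeasure_PiM_emb) (auto simp: sets_uniform_count_measure)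
    also have "\<dots> = (\<Prod>j\<in>J. emeasure (?u j) (F j))"
      using F' by (intro prod.cong refl inv)
    finally show "emeasure (distr ?P ?P (?t a)) ?E = (\<Prod>j\<in>J. emeasure (?u j) (F j))" .
  qed simp
  have "emeasure ?P (?t a ` A) = emeasure ?P A" if a: "a \<in> ?C" and A: "A \<in> sets ?P" for a A
  proof -
    let ?b = "inv\<^bsub>vilenkin_group m\<^esub> a"
    have b: "?b \<in> ?C" using a by simp
    have AC: "A \<subseteq> ?C" using sets.sets_into_space[OF A] spP by simp
    have 1: "?t ?b (?t a x) = x" "?t a (?t ?b x) = x" if "x \<in> ?C" for x
      using a b that by (simp_all flip: G.m_assoc)
    have "?t a ` A = ?t ?b -` A \<inter> space ?P"
    proof (rule Set.set_eqI)
      fix y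
      have "y \<in> ?t a ` A \<Longrightarrow> y \<in> ?t ?b -` A \<inter> ?C"
        using 1(1) AC a by (auto intro: G.m_closed simp del: mult_product_group)
      moreover have "y \<in> ?t a ` A" if "y \<in> ?C" "?t ?b y \<in> A"
        using 1(2)[OF that(1)] that(2) by (metis image_eqI)
      ultimately show "y \<in> ?t a ` A \<longleftrightarrow> y \<in> ?t ?b -` A \<inter> space ?P"
        unfolding spP by blast
    qed
    then have "emeasure ?P (?t a ` A) = emeasure (distr ?P ?P (?t ?b)) A"
      using A tm by (simp add: emeasure_distr)
    then show ?thesis by (simp add: ds)
  qed
  moreover have "emeasure ?P ?C = 1"
    using P.emeasure_space_1 spP by simp
  ultimately show ?thesis
    unfolding normalized_haar_def using spP sets_PiM_vilenkin[of m, OF m] by blast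
qed

end

theory Submission
  imports Defs
begin

text \<open>Let \<open>D n\<close> be the Dirichlet kernels and \<open>F n = D 1 + \<dots> + D n\<close>. Take a martingale whose Fourier
  coefficients equal a constant \<open>b k\<close> on the block \<open>[M (\<alpha> k), M (\<alpha> k + 1))\<close> for a sparse sequence
  \<open>\<alpha>\<close> and vanish elsewhere; with \<open>b k = (2^-k * M (\<alpha> k)) powr (1/p) / M (\<alpha> k)\<close> its maximal function
  is dominated by a sum of indicators of cylinders around 0 that is \<open>p\<close>-integrable. For
  \<open>n = M (\<alpha> k) + s\<close> with \<open>s \<le> M (\<alpha> k)\<close> the \<open>n\<close>-th Fejer mean has modulus at least
  \<open>b k * |F s| / n - L\<close>, where \<open>L\<close> depends only on the earlier blocks and hence can be beaten by the
  choice of \<open>\<alpha> k\<close>.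

  For \<open>p < 1/2\<close> already \<open>s = 1\<close> works, since \<open>b k / n\<close> behaves like \<open>M (\<alpha> k) powr (1/p - 2)\<close>.
  For \<open>p = 1/2\<close> one takes \<open>s = M 0 + M 2 + \<dots> + M (2 * (A - 1))\<close>: if the first nonzero coordinate of
  \<open>x\<close> has index \<open>t = 2 * i\<close> and the next coordinate is nonzero as well, then all terms beyond the
  \<open>i\<close>-th drop out of \<open>F s x\<close> and \<open>|F s x| \<ge> (M t)^2 / 2\<close>. Such points form a set of measure at
  least a constant times \<open>1 / M t\<close>, so the integral of \<open>|F s| powr (1/2)\<close> grows linearly in \<open>A\<close>.\<close>

section \<open>Dirichlet and Fejer kernels\<close>

definition dirichlet :: "(nat \<Rightarrow> nat) \<Rightarrow> nat \<Rightarrow> (nat \<Rightarrow> int) \<Rightarrow> complex" where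
  "dirichlet m n x = (\<Sum>k<n. vilenkin m k x)"

definition fejer_sum :: "(nat \<Rightarrow> nat) \<Rightarrow> nat \<Rightarrow> (nat \<Rightarrow> int) \<Rightarrow> complex" where
  "fejer_sum m n x = (\<Sum>j=1..n. dirichlet m j x)"

lemma dirichlet_0 [simp]: "dirichlet m 0 x = 0"
  by (simp add: dirichlet_def)

lemma dirichlet_add: "dirichlet m (a + b) x = dirichlet m a x + (\<Sum>k<b. vilenkin m (a + k) x)"
proof (induction b)
  case (Suc b)
  then show ?case by (simp add: dirichlet_def add.assoc)
qed simp

lemma fejer_sum_0 [simp]: "fejer_sum m 0 x = 0"
  by (simp add: fejer_sum_def)

lemma fejer_sum_Suc [simp]: "fejer_sum m (Suc n) x = fejer_sum m n x + dirichlet m (Suc n) x"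
  by (simp add: fejer_sum_def)

locale vilenkin_system =
  fixes m :: "nat \<Rightarrow> nat"
  assumes m_ge2: "\<And>k. 2 \<le> m k"
begin

abbreviation "C \<equiv> carrier (vilenkin_group m)"
abbreviation "M \<equiv> M_seq m"
abbreviation "r \<equiv> rademacher m"
abbreviation "\<psi> \<equiv> vilenkin m"
abbreviation "D \<equiv> dirichlet m"
abbreviation "F \<equiv> fejer_sum m"

lemma m_pos: "0 < m k"
  using m_ge2[of k] by linarith

lemma M_pos: "0 < M k"
  using M_seq_ge[of m k] m_ge2 by fastforce

lemma less_M: "k < M k"
  using M_seq_ge[of m k] m_ge2 by blast

lemma M_less_Suc: "M k < M (Suc k)"
proof -
  have "2 * M k \<le> m k * M k" using m_ge2[of k] by (rule mult_le_mono1)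
  then show ?thesis using M_pos[of k] by (simp add: M_seq_rec)
qed

lemma strict_mono_M: "strict_mono M"
  by (rule strict_mono_Suc_iff[THEN iffD2]) (simp add: M_less_Suc)

lemma M_mono: "j \<le> k \<Longrightarrow> M j \<le> M k"
  using strict_mono_M by (simp add: strict_mono_less_eq)

lemma M_dvd: "i \<le> k \<Longrightarrow> M i dvd M k"
  by (induction k rule: dec_induct) (auto simp: M_seq_rec)

lemma mem_C_iff: "x \<in> C \<longleftrightarrow> (\<forall>k. 0 \<le> x k \<and> x k < int (m k))"
  using carrier_vilenkin_group[of m, OF m_ge2] by (auto simp: PiE_iff)

lemma norm_r [simp]: "norm (r k x) = 1"
proof -
  have "r k x = cis (2 * pi * real_of_int (x k) / real (m k))"
    by (simp add: rademacher_def cis_conv_exp field_simps)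
  then show ?thesis by simp
qed

text \<open>All digits of index at least \<open>N\<close> vanish when \<open>n < M N\<close>. Since
  any such \<open>N\<close> is allowed, characters of different indices can be written over one
  common range.\<close>

lemma vilenkin_eq_prod:
  assumes "n < M N" shows "\<psi> n x = (\<Prod>k<N. r k x ^ digit m n k)"
  unfolding vilenkin_def
proof (rule prodinf_finite)
  fix k assume "k \<notin> {..<N}"
  then have "n < M k" using assms M_mono[of N k] by simp
  then show "r k x ^ digit m n k = 1" by (simp add: digit_def)
qed simp

lemma norm_vilenkin [simp]: "norm (\<psi> n x) = 1"
  by (simp add: vilenkin_eq_prod[OF less_M] norm_power flip: prod_norm)

section \<open>Block decomposition of characters and kernels\<close>

lemma block_less:
  assumes "j < m a" "t < M a" shows "j * M a + t < M (Suc a)"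
proof -
  have "j * M a + t < (j + 1) * M a" using assms by simp
  also have "\<dots> \<le> m a * M a" using assms by (intro mult_le_mono1) simp
  finally show ?thesis by (simp add: M_seq_rec)
qed

text \<open>Adding \<open>j * M a\<close> to \<open>t < M a\<close> only sets the digit of index
  \<open>a\<close> to \<open>j\<close>: for \<open>i < a\<close> the added number is a multiple of
  \<open>M (Suc i)\<close>, so the lower digits do not change.\<close>

lemma vilenkin_block:
  assumes "j < m a" "t < M a"
  shows "\<psi> (j * M a + t) x = r a x ^ j * \<psi> t x"
proof -
  have low: "digit m (j * M a + t) i = digit m t i" if "i < a" for i
  proof -
    obtain q where q: "M a = M (Suc i) * q"
      using M_dvd[of "Suc i" a] \<open>i < a\<close> by (auto elim: dvdE)
    have "j * M a + t = (j * m i * q) * M i + t" by (simp add: q M_seq_rec)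
    then have "(j * M a + t) div M i = ((j * m i * q) * M i + t) div M i" by (rule arg_cong)
    also have "\<dots> = j * m i * q + t div M i"
      using M_pos[of i] by simp
    also have "\<dots> = m i * (j * q) + t div M i" by simp
    finally show ?thesis unfolding digit_def by (simp only: mod_mult_self4)
  qed
  have "digit m (j * M a + t) a = j"
    using assms M_pos[of a] by (simp add: digit_def)
  with low show ?thesis
    by (simp add: vilenkin_eq_prod[OF block_less[OF assms]] vilenkin_eq_prod[OF assms(2)] mult.commute)
qed

lemma vilenkin_0 [simp]: "\<psi> 0 x = 1"
  using vilenkin_eq_prod[of 0 0 x] by (simp add: M_seq_rec)

lemma r_eq_1_iff:
  assumes "x \<in> C" shows "r k x = 1 \<longleftrightarrow> x k = 0"
proof
  assume "r k x = 1"
  then have "exp (2 * of_real pi * \<i> * of_int (x k) / of_nat (m k)) = (1::complex)"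
    by (simp add: rademacher_def)
  then obtain n :: int where "2 * pi * real_of_int (x k) / real (m k) = of_int (2 * n) * pi"
    by (auto simp: exp_eq_1)
  then have "real_of_int (x k) = real_of_int (n * int (m k))"
    using m_pos[of k] by (simp add: field_simps)
  then have "x k = n * int (m k)" by linarith
  moreover have "0 \<le> x k" "x k < int (m k)" using assms by (auto simp: mem_C_iff)
  ultimately show "x k = 0"
    by (metis mod_mult_self2_is_0 mod_pos_pos_trivial)
qed (simp add: rademacher_def)

lemma r_power_m: "r k x ^ m k = 1"
proof -
  have "r k x ^ m k = exp (of_nat (m k) * (2 * of_real pi * \<i> * of_int (x k) / of_nat (m k)))"
    unfolding rademacher_def by (rule exp_of_nat_mult[symmetric])
  also have "\<dots> = exp (2 * of_real pi * \<i> * of_int (x k))"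
    using m_pos[of k] by simp
  also have "\<dots> = 1"
    by (auto simp: exp_eq_1 intro!: exI[of _ "x k"])
  finally show ?thesis .
qed

lemma sum_r_power:
  assumes "x \<in> C" shows "(\<Sum>j<m a. r a x ^ j) = (if x a = 0 then of_nat (m a) else 0)"
proof (cases "x a = 0")
  case True
  then show ?thesis by (simp add: rademacher_def)
next
  case False
  then have "r a x \<noteq> 1" using r_eq_1_iff[OF assms] by simp
  then show ?thesis using False by (simp add: geometric_sum r_power_m)
qed

text \<open>The bound on \<open>t\<close> is not strict because \<open>D t\<close> involves only
  indices below \<open>t\<close>; a complete run \<open>t = M a\<close> is thus covered.\<close>

lemma dirichlet_block:
  assumes "j < m a" "t \<le> M a"
  shows "D (j * M a + t) x = D (j * M a) x + r a x ^ j * D t x"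
  using assms by (simp add: dirichlet_add vilenkin_block dirichlet_def[of _ t] sum_distrib_left)

lemma dirichlet_mult_M:
  "j \<le> m a \<Longrightarrow> D (j * M a) x = (\<Sum>i<j. r a x ^ i) * D (M a) x"
proof (induction j)
  case (Suc j)
  have "D (j * M a + M a) x = D (j * M a) x + r a x ^ j * D (M a) x"
    using Suc.prems by (intro dirichlet_block) auto
  then show ?case using Suc by (simp add: algebra_simps)
qed simp

text \<open>Passing from \<open>M a\<close> to \<open>M (Suc a)\<close> multiplies the kernel by the
  sum of the powers of \<open>r a x\<close>, which is \<open>m a\<close> or 0 according to whether
  \<open>x a = 0\<close>.\<close>

lemma dirichlet_M:
  assumes "x \<in> C"
  shows "D (M a) x = (if \<forall>i<a. x i = 0 then of_nat (M a) else 0)"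
proof (induction a)
  case 0
  show ?case by (simp add: M_seq_rec dirichlet_def)
next
  case (Suc a)
  then show ?case
    using dirichlet_mult_M[of "m a" a x] assms
    by (auto simp: M_seq_rec sum_r_power less_Suc_eq)
qed

lemma fejer_sum_block:
  assumes "j < m a" "t \<le> M a"
  shows "F (j * M a + t) x = F (j * M a) x + of_nat t * D (j * M a) x + r a x ^ j * F t x"
  using assms(2)
proof (induction t)
  case (Suc t)
  have "D (j * M a + Suc t) x = D (j * M a) x + r a x ^ j * D (Suc t) x"
    using assms(1) Suc.prems by (rule dirichlet_block)
  then show ?case using Suc by (simp add: algebra_simps)
qed simp

text \<open>If \<open>D (M a) x\<close> vanishes, so does every \<open>D (j * M a) x\<close> with
  \<open>j \<le> m a\<close>. The cross terms of \<open>fejer_sum_block\<close> disappear and each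
  run contributes \<open>F (M a) x\<close> times a power of \<open>r a x\<close>.\<close>

lemma fejer_sum_M_Suc:
  assumes "D (M a) x = 0"
  shows "F (M (Suc a)) x = (\<Sum>j<m a. r a x ^ j) * F (M a) x"
proof -
  have "j \<le> m a \<Longrightarrow> F (j * M a) x = (\<Sum>i<j. r a x ^ i) * F (M a) x" for j
  proof (induction j)
    case (Suc j)
    have "F (j * M a + M a) x = F (j * M a) x + of_nat (M a) * D (j * M a) x + r a x ^ j * F (M a) x"
      using Suc.prems by (intro fejer_sum_block) auto
    then show ?case
      using Suc assms dirichlet_mult_M[of j a x] by (simp add: algebra_simps)
  qed simp
  then show ?thesis by (simp add: M_seq_rec)
qed

section \<open>Lower bounds for Fejer sums on gap sets\<close>

definition gap_set :: "nat \<Rightarrow> (nat \<Rightarrow> int) set" where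
  "gap_set t = {x \<in> C. (\<forall>i<t. x i = 0) \<and> x t \<noteq> 0 \<and> x (Suc t) \<noteq> 0}"

lemma gap_set_disjoint: "x \<in> gap_set s \<Longrightarrow> x \<in> gap_set t \<Longrightarrow> s = t"
  unfolding gap_set_def by (metis (no_types, lifting) linorder_neqE_nat mem_Collect_eq)

text \<open>The two nonzero coordinates have separate tasks: \<open>x t \<noteq> 0\<close> kills
  \<open>D (M a) x\<close> for all \<open>a > t\<close>, and \<open>x (Suc t) \<noteq> 0\<close>
  kills the geometric factor in the step from \<open>t + 1\<close> to \<open>t + 2\<close>. Once
  zero, the value stays zero.\<close>

lemma fejer_sum_M_gap:
  assumes x: "x \<in> gap_set t" and a: "t + 2 \<le> a"
  shows "F (M a) x = 0"
  using a
proof (induction a rule: dec_induct)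
  have xC: "x \<in> C" and nz: "x t \<noteq> 0" "x (Suc t) \<noteq> 0" using x by (auto simp: gap_set_def)
  have D0: "D (M a) x = 0" if "t < a" for a
    using that nz by (auto simp: dirichlet_M[OF xC])
  {
    case base
    show ?case using nz D0[of "Suc t"] by (simp add: fejer_sum_M_Suc sum_r_power[OF xC])
  next
    case (step a)
    then show ?case using D0[of a] by (simp add: fejer_sum_M_Suc)
  }
qed

text \<open>Every character of index below \<open>M t\<close> equals 1 here, so the Dirichlet
  kernels involved take the values 1 to \<open>n\<close>.\<close>

lemma fejer_sum_on_cylinder:
  assumes "x \<in> C" "\<forall>i<t. x i = 0" "n \<le> M t"
  shows "F n x = of_real (real n * (real n + 1) / 2)"
  using assms(3)
proof (induction n)
  case (Suc n)
  have "D (Suc n) x = (\<Sum>k<Suc n. 1)"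
    unfolding dirichlet_def
  proof (rule sum.cong)
    fix k assume "k \<in> {..<Suc n}"
    then have "k < M t" using Suc.prems by simp
    then show "\<psi> k x = 1"
      using assms(2) by (simp add: vilenkin_eq_prod rademacher_def)
  qed simp
  then show ?case using Suc by (simp add: field_simps)
qed simp

text \<open>The stride 2 leaves room for the coordinates \<open>2 * i\<close> and
  \<open>2 * i + 1\<close> of a gap set: the next summand \<open>M (2 * i + 2)\<close> is the first
  to which \<open>fejer_sum_M_gap\<close> applies.\<close>

definition even_sum :: "nat \<Rightarrow> nat" where
  "even_sum A = (\<Sum>i<A. M (2 * i))"

text \<open>This makes \<open>even_sum (Suc A)\<close> a sum \<open>M (2 * A) + t\<close> with
  \<open>t \<le> M (2 * A)\<close>, the form that the block formula with \<open>j = 1\<close>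
  needs.\<close>

lemma even_sum_le: "even_sum A \<le> M (2 * A)"
proof (induction A)
  case (Suc A)
  have "even_sum (Suc A) \<le> 2 * M (2 * A)" using Suc by (simp add: even_sum_def)
  also have "\<dots> \<le> m (2 * A) * M (2 * A)" using m_ge2 by (rule mult_le_mono1)
  also have "\<dots> \<le> M (2 * Suc A)" using M_mono[of "Suc (2 * A)" "2 * Suc A"] by (simp add: M_seq_rec)
  finally show ?case .
qed (simp add: even_sum_def)

lemma fejer_sum_even_sum_Suc:
  "F (even_sum (Suc A)) x =
     F (M (2 * A)) x + of_nat (even_sum A) * D (M (2 * A)) x + r (2 * A) x * F (even_sum A) x"
  using fejer_sum_block[of 1 "2 * A" "even_sum A" x] m_ge2[of "2 * A"] even_sum_le[of A]
  by (simp add: even_sum_def add.commute)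

lemma fejer_sum_even_sum_ge:
  assumes x: "x \<in> gap_set (2 * i)" and "i < A"
  shows "(real (M (2 * i)))\<^sup>2 / 2 \<le> norm (F (even_sum A) x)"
proof -
  have xC: "x \<in> C" and z: "\<forall>j<2*i. x j = 0" and nz: "x (2 * i) \<noteq> 0" using x by (auto simp: gap_set_def)
  have "Suc i \<le> A" using assms by simp
  then show ?thesis
  proof (induction A rule: dec_induct)
    case base
    define N where "N = real (M (2 * i))"
    define s where "s = real (even_sum i)"
    have s: "0 \<le> s" "s \<le> N" "1 \<le> N"
      using even_sum_le[of i] M_pos[of "2 * i"] by (simp_all add: s_def N_def)
    \<comment> \<open>Together these give \<open>s * (s + 1) / 2 \<le> s * N\<close>: the cross term
      absorbs the one summand with an uncontrolled phase.\<close>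
    have sN: "s * s \<le> s * N" "s * 1 \<le> s * N" using s by (intro mult_left_mono; simp)+
    have 1: "F (M (2 * i)) x = of_real (N * (N + 1) / 2)"
      unfolding N_def by (rule fejer_sum_on_cylinder[OF xC z]) simp
    have 2: "F (even_sum i) x = of_real (s * (s + 1) / 2)"
      unfolding s_def by (rule fejer_sum_on_cylinder[OF xC z even_sum_le])
    have 3: "D (M (2 * i)) x = of_real N"
      using z by (simp add: dirichlet_M[OF xC] N_def)
    have "F (even_sum (Suc i)) x = of_real (N * (N + 1) / 2 + s * N) + r (2 * i) x * F (even_sum i) x"
      by (simp add: fejer_sum_even_sum_Suc 1 3 s_def)
    moreover have "norm (r (2 * i) x * F (even_sum i) x) = s * (s + 1) / 2"
      unfolding 2 norm_mult norm_r norm_of_real using s by simp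
    moreover have "norm (of_real (N * (N + 1) / 2 + s * N) :: complex) = N * (N + 1) / 2 + s * N"
      unfolding norm_of_real using s by simp
    ultimately have "N * (N + 1) / 2 + s * N - s * (s + 1) / 2 \<le> norm (F (even_sum (Suc i)) x)"
      by (metis norm_diff_ineq)
    moreover have "N\<^sup>2 / 2 \<le> N * (N + 1) / 2 + s * N - s * (s + 1) / 2"
      using sN s by (simp add: field_simps power2_eq_square)
    ultimately show ?case unfolding N_def by linarith
  next
    case (step A)
    \<comment> \<open>Since \<open>2 * A \<ge> 2 * i + 2\<close>, the first two terms of the
      recursion vanish and only a factor of modulus 1 is left.\<close>
    have "F (M (2 * A)) x = 0"
      using step.hyps by (intro fejer_sum_M_gap[OF x]) auto
    moreover have "D (M (2 * A)) x = 0"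
      using step.hyps nz by (auto simp: dirichlet_M[OF xC])
    ultimately show ?case
      using step.IH by (simp add: fejer_sum_even_sum_Suc norm_mult)
  qed
qed

end

section \<open>Integration on the Vilenkin group\<close>

locale vilenkin_haar = vilenkin_system +
  fixes \<mu> :: "(nat \<Rightarrow> int) measure"
  assumes haar: "normalized_haar (vilenkin_group m) (vilenkin_topology m) \<mu>"
begin

abbreviation "Z \<equiv> \<lambda>k. uniform_count_measure {0..<int (m k)}"

section \<open>Measurability of cylinders, gap sets and characters\<close>

lemma space_\<mu> [simp]: "space \<mu> = C"
  using haar unfolding normalized_haar_def by (rule conjunct1)

sublocale prob_space \<mu>
proof (rule prob_spaceI)
  show "emeasure \<mu> (space \<mu>) = 1"
    using haar unfolding normalized_haar_def space_\<mu> by (elim conjE)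
qed

lemma sets_\<mu>: "sets \<mu> = sets (Pi\<^sub>M UNIV Z)"
  using haar unfolding normalized_haar_def sets_PiM_vilenkin[of m, OF m_ge2] by (elim conjE)

lemma coord_measurable: "(\<lambda>x. x k) \<in> \<mu> \<rightarrow>\<^sub>M Z k"
  unfolding measurable_cong_sets[OF sets_\<mu> refl]
  by (rule measurable_component_singleton) simp

lemma sets_coord_eq: "{y \<in> space \<mu>. y k = c} \<in> sets \<mu>"
proof -
  have "(\<lambda>y. y k) -` ({c} \<inter> {0..<int (m k)}) \<inter> space \<mu> \<in> sets \<mu>"
    by (rule measurable_sets[OF coord_measurable]) (simp add: sets_uniform_count_measure)
  also have "(\<lambda>y. y k) -` ({c} \<inter> {0..<int (m k)}) \<inter> space \<mu> = {y \<in> space \<mu>. y k = c}"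
    by (auto simp: mem_C_iff)
  finally show ?thesis .
qed

lemma sets_cylinder [measurable]: "cylinder m n x \<in> sets \<mu>"
proof -
  have "cylinder m n x = {y \<in> space \<mu>. \<forall>j\<in>{..<n}. y j = x j}"
    unfolding cylinder_def space_\<mu> by blast
  also have "\<dots> \<in> sets \<mu>"
    by (rule sets.sets_Collect_finite_All[OF sets_coord_eq finite_lessThan])
  finally show ?thesis .
qed

lemma sets_gap_set [measurable]: "gap_set t \<in> sets \<mu>"
proof -
  have "cylinder m t (\<lambda>_. 0) - {y \<in> space \<mu>. y t = 0} - {y \<in> space \<mu>. y (Suc t) = 0} \<in> sets \<mu>"
    by (intro sets.Diff sets_coord_eq sets_cylinder)
  also have "cylinder m t (\<lambda>_. 0) - {y \<in> space \<mu>. y t = 0} - {y \<in> space \<mu>. y (Suc t) = 0} = gap_set t"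
    by (auto simp: gap_set_def cylinder_def)
  finally show ?thesis .
qed

lemma space_filtration: "space (filtration m n) = C"
  and sets_filtration: "sets (filtration m n) = sigma_sets C (cylinder m n ` C)"
proof -
  have "cylinder m n ` C \<subseteq> Pow C" unfolding cylinder_def by blast
  then show "space (filtration m n) = C" "sets (filtration m n) = sigma_sets C (cylinder m n ` C)"
    unfolding filtration_def by (rule space_measure_of, rule sets_measure_of)
qed

text \<open>The preimage of any set is a union of cylinders of rank \<open>n\<close>, of which there
  are only countably many.\<close>

lemma borel_measurable_filtration:
  fixes g :: "(nat \<Rightarrow> int) \<Rightarrow> complex"
  assumes g: "\<And>x y. x \<in> C \<Longrightarrow> y \<in> C \<Longrightarrow> \<forall>j<n. x j = y j \<Longrightarrow> g x = g y"
  shows "g \<in> borel_measurable (filtration m n)"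
proof (rule measurableI)
  fix A :: "complex set"
  have "countable (cylinder m n ` C)"
  proof (rule countable_subset)
    \<comment> \<open>A cylinder is determined by the list of the first \<open>n\<close> values of
      its centre, and lists of integers are countable.\<close>
    let ?f = "\<lambda>l. {y \<in> C. \<forall>j<length l. y j = l ! j}"
    have "cylinder m n x = ?f (map x [0..<n])" for x by (simp add: cylinder_def)
    then show "cylinder m n ` C \<subseteq> range ?f" by blast
  qed simp
  then have "countable (cylinder m n ` {x \<in> C. g x \<in> A})"
    by (rule countable_subset[rotated]) blast
  moreover have "cylinder m n ` {x \<in> C. g x \<in> A} \<subseteq> sets (filtration m n)"
    unfolding sets_filtration by (blast intro: sigma_sets.Basic)
  ultimately have "(\<Union>x\<in>{x \<in> C. g x \<in> A}. cylinder m n x) \<in> sets (filtration m n)"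
    by (rule sets.countable_Union)
  also have "(\<Union>x\<in>{x \<in> C. g x \<in> A}. cylinder m n x) = g -` A \<inter> space (filtration m n)"
  proof (intro subset_antisym subsetI)
    fix y assume "y \<in> (\<Union>x\<in>{x \<in> C. g x \<in> A}. cylinder m n x)"
    then obtain x where x: "x \<in> C" "g x \<in> A" "y \<in> cylinder m n x" by blast
    then have "y \<in> C" "\<forall>j<n. x j = y j" by (simp_all add: cylinder_def)
    then show "y \<in> g -` A \<inter> space (filtration m n)"
      using g[of x y] x unfolding space_filtration by simp
  next
    fix y assume "y \<in> g -` A \<inter> space (filtration m n)"
    then have y: "y \<in> C" "g y \<in> A" unfolding space_filtration by blast+
    then have "y \<in> cylinder m n y" by (simp add: cylinder_def)
    with y show "y \<in> (\<Union>x\<in>{x \<in> C. g x \<in> A}. cylinder m n x)" by blast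
  qed
  finally show "g -` A \<inter> space (filtration m n) \<in> sets (filtration m n)" .
qed simp

lemma borel_measurable_filtrationD:
  fixes g :: "(nat \<Rightarrow> int) \<Rightarrow> complex"
  assumes "g \<in> borel_measurable (filtration m n)" shows "g \<in> borel_measurable \<mu>"
proof (rule measurableI)
  fix A :: "complex set" assume "A \<in> sets borel"
  then have "g -` A \<inter> C \<in> sigma_sets C (cylinder m n ` C)"
    by (rule measurable_sets[OF assms, unfolded space_filtration sets_filtration])
  moreover have "sigma_sets C (cylinder m n ` C) \<subseteq> sets \<mu>"
    using sets.sigma_sets_subset[of "cylinder m n ` C" \<mu>] sets_cylinder unfolding space_\<mu> by blast
  ultimately show "g -` A \<inter> space \<mu> \<in> sets \<mu>" unfolding space_\<mu> by (rule rev_subsetD)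
qed simp

lemma vilenkin_filtration:
  assumes "n < M N" shows "\<psi> n \<in> borel_measurable (filtration m N)"
  by (rule borel_measurable_filtration)
    (auto simp: vilenkin_eq_prod[OF assms] rademacher_def intro!: prod.cong)

lemma vilenkin_measurable [measurable]: "\<psi> n \<in> borel_measurable \<mu>"
  by (rule borel_measurable_filtrationD[OF vilenkin_filtration[OF less_M]])

lemma cnj_vilenkin_measurable [measurable]: "(\<lambda>x. cnj (\<psi> n x)) \<in> borel_measurable \<mu>"
  by (rule measurable_compose[OF vilenkin_measurable borel_measurable_continuous_onI])
    (intro continuous_intros)

section \<open>Translation invariance and orthonormality\<close>

abbreviation tr :: "(nat \<Rightarrow> int) \<Rightarrow> (nat \<Rightarrow> int) \<Rightarrow> nat \<Rightarrow> int" where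
  "tr a x \<equiv> a \<otimes>\<^bsub>vilenkin_group m\<^esub> x"

lemma tr_eq: "tr a x = (\<lambda>k. (a k + x k) mod int (m k))"
  by (simp add: vilenkin_group_def restrict_def)

lemma tr_closed: "tr a x \<in> C"
  using m_pos by (simp add: mem_C_iff tr_eq)

text \<open>The pointwise negative serves as inverse although it may lie outside \<open>C\<close>,
  because \<open>tr\<close> reduces every coordinate modulo \<open>m k\<close>.\<close>

lemma tr_inverse:
  assumes "x \<in> C" shows "tr (\<lambda>k. - a k) (tr a x) = x" "tr a (tr (\<lambda>k. - a k) x) = x"
  using assms by (auto simp: mem_C_iff tr_eq mod_simps)

lemma tr_measurable: "tr a \<in> \<mu> \<rightarrow>\<^sub>M \<mu>"
proof -
  have "tr a \<in> \<mu> \<rightarrow>\<^sub>M Pi\<^sub>M UNIV Z"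
  proof (rule measurable_PiM_single')
    fix k
    have "(\<lambda>y. (a k + y) mod int (m k)) \<in> Z k \<rightarrow>\<^sub>M Z k"
      using m_pos[of k]
      by (auto simp: measurable_def space_uniform_count_measure sets_uniform_count_measure)
    then show "(\<lambda>x. tr a x k) \<in> \<mu> \<rightarrow>\<^sub>M Z k"
      unfolding tr_eq by (rule measurable_compose[OF coord_measurable])
  next
    show "tr a \<in> space \<mu> \<rightarrow> (\<Pi>\<^sub>E k\<in>UNIV. space (Z k))"
      using m_pos by (auto simp: tr_eq space_uniform_count_measure)
  qed
  then show ?thesis unfolding measurable_cong_sets[OF refl sets_\<mu>] .
qed

lemma emeasure_tr_image:
  assumes "a \<in> C" "A \<in> sets \<mu>" shows "emeasure \<mu> (tr a ` A) = emeasure \<mu> A"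
  using haar assms unfolding normalized_haar_def by blast

lemma integral_tr:
  fixes g :: "(nat \<Rightarrow> int) \<Rightarrow> complex"
  assumes "a \<in> C" and [measurable]: "g \<in> borel_measurable \<mu>"
  shows "(LINT x|\<mu>. g (tr a x)) = (LINT x|\<mu>. g x)"
proof -
  have "distr \<mu> \<mu> (tr a) = \<mu>"
  proof (rule measure_eqI)
    fix A assume "A \<in> sets (distr \<mu> \<mu> (tr a))"
    then have A: "A \<in> sets \<mu>" by simp
    let ?B = "tr a -` A \<inter> space \<mu>"
    have B: "?B \<in> sets \<mu>" using tr_measurable A by (rule measurable_sets)
    \<comment> \<open>Haar invariance is stated for images, while \<open>distr\<close> is about
      preimages; surjectivity of the translation links the two.\<close>
    have "A = tr a ` ?B"
    proof (intro subset_antisym subsetI)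
      fix x assume x: "x \<in> A"
      then have "x \<in> C" using sets.sets_into_space[OF A] unfolding space_\<mu> by (rule rev_subsetD)
      then have inv: "tr a (tr (\<lambda>k. - a k) x) = x" by (rule tr_inverse)
      have "tr (\<lambda>k. - a k) x \<in> ?B"
        unfolding Int_iff vimage_eq inv space_\<mu> using x tr_closed by (rule conjI)
      then show "x \<in> tr a ` ?B" by (rule rev_image_eqI) (rule inv[symmetric])
    qed blast
    then have "emeasure \<mu> A = emeasure \<mu> ?B"
      using emeasure_tr_image[OF assms(1) B] by simp
    then show "emeasure (distr \<mu> \<mu> (tr a)) A = emeasure \<mu> A"
      using A tr_measurable by (simp add: emeasure_distr)
  qed simp
  then show ?thesis
    using integral_distr[OF tr_measurable[of a] assms(2)] by simp
qed

lemma rademacher_tr: "r k (tr a x) = r k a * r k x"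
proof -
  have "(a k + x k) = (a k + x k) div int (m k) * int (m k) + (a k + x k) mod int (m k)"
    by simp
  then obtain q where q: "(a k + x k) mod int (m k) = a k + x k - q * int (m k)"
    by (metis add_diff_cancel_left')
  have "r k (tr a x) = exp (2 * of_real pi * \<i> * of_int (a k) / of_nat (m k)
      + 2 * of_real pi * \<i> * of_int (x k) / of_nat (m k) - of_int q * (2 * of_real pi * \<i>))"
    using m_pos[of k] by (simp add: rademacher_def tr_eq q field_simps)
  also have "\<dots> = r k a * r k x / exp (of_int q * (2 * of_real pi * \<i>))"
    unfolding exp_diff exp_add rademacher_def ..
  also have "exp (of_int q * (2 * of_real pi * \<i>)) = 1"
    by (auto simp: exp_eq_1 intro!: exI[of _ q])
  finally show ?thesis by simp
qed

lemma vilenkin_tr: "\<psi> n (tr a x) = \<psi> n a * \<psi> n x"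
  by (simp add: vilenkin_eq_prod[OF less_M] rademacher_tr power_mult_distrib prod.distrib)

definition unit_vec :: "nat \<Rightarrow> nat \<Rightarrow> int" where
  "unit_vec k = (\<lambda>i. if i = k then 1 else 0)"

lemma unit_vec_in_C: "unit_vec k \<in> C"
proof -
  have "1 < int (m i)" for i using m_ge2[of i] by linarith
  moreover have "0 < int (m i)" for i using m_pos by simp
  ultimately show ?thesis unfolding mem_C_iff unit_vec_def by simp
qed

lemma vilenkin_unit_vec: "\<psi> n (unit_vec l) = cis (2 * pi * real (digit m n l) / real (m l))"
proof -
  have "r k (unit_vec l) = (if k = l then cis (2 * pi / real (m l)) else 1)" for k
    by (simp add: rademacher_def unit_vec_def cis_conv_exp field_simps)
  \<comment> \<open>The range of the product must cover all digits of \<open>n\<close> and also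
    contain the index \<open>l\<close>.\<close>
  moreover have "n < M (max n (Suc l))"
    using less_M[of n] M_mono[of n "max n (Suc l)"] by simp
  ultimately have "\<psi> n (unit_vec l) =
      (\<Prod>k<max n (Suc l). if k = l then cis (2 * pi / real (m l)) ^ digit m n l else 1)"
    unfolding vilenkin_eq_prod[OF \<open>n < M (max n (Suc l))\<close>] by (intro prod.cong) auto
  then have "\<psi> n (unit_vec l) = cis (2 * pi / real (m l)) ^ digit m n l"
    by (simp add: less_max_iff_disj)
  also have "\<dots> = cis (real (digit m n l) * (2 * pi / real (m l)))" by (rule Complex.DeMoivre)
  also have "real (digit m n l) * (2 * pi / real (m l)) = 2 * pi * real (digit m n l) / real (m l)" by simp
  finally show ?thesis .
qed

lemma digit_less: "digit m n l < m l"
  using m_pos by (simp add: digit_def)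

text \<open>For \<open>i \<noteq> j\<close> some digit \<open>l\<close> differs. The product of
  characters is multiplicative, so translation by \<open>unit_vec l\<close> multiplies its integral
  by a number different from 1 and at the same time leaves it unchanged; the integral is therefore
  0.\<close>

lemma integral_vilenkin_orthonormal:
  "(LINT x|\<mu>. \<psi> i x * cnj (\<psi> j x)) = (if i = j then 1 else 0)"
proof (cases "i = j")
  case True
  then show ?thesis by (simp add: prob_space[simplified] flip: complex_norm_square)
next
  case False
  have "\<exists>l. digit m i l \<noteq> digit m j l"
  proof (rule ccontr)
    assume "\<not> ?thesis"
    \<comment> \<open>Both numbers are below \<open>M (max i j)\<close>, hence equal to these
      residues, which the digits determine.\<close>
    then have "i mod M (max i j) = j mod M (max i j)"
      unfolding digit_partial[symmetric] by simp
    then show False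
      using False less_M[of "max i j"] by simp
  qed
  then obtain l where l: "digit m i l \<noteq> digit m j l" by blast
  let ?g = "\<lambda>x. \<psi> i x * cnj (\<psi> j x)"
  let ?e = "unit_vec l"
  have "?g ?e \<noteq> 1"
  proof
    assume "?g ?e = 1"
    then have "\<psi> i ?e * (cnj (\<psi> j ?e) * \<psi> j ?e) = \<psi> j ?e" by (simp add: mult_ac)
    moreover have "cnj (\<psi> j ?e) * \<psi> j ?e = 1"
      by (subst mult.commute) (simp flip: complex_norm_square)
    ultimately have "\<psi> i ?e = \<psi> j ?e" by simp
    then have *: "cis (2 * pi * real (digit m i l) / real (m l)) = cis (2 * pi * real (digit m j l) / real (m l))"
      by (simp add: vilenkin_unit_vec)
    have "inj_on (\<lambda>k. cis (2 * pi * real k / real (m l))) {..<m l}"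
      using Complex.bij_betw_roots_unity[OF m_pos[of l]] by (simp add: bij_betw_def)
    then have "digit m i l = digit m j l" using * by (rule inj_onD) (simp_all add: digit_less)
    with l show False by simp
  qed
  moreover have "(LINT x|\<mu>. ?g x) = ?g ?e * (LINT x|\<mu>. ?g x)"
  proof -
    have "(LINT x|\<mu>. ?g x) = (LINT x|\<mu>. ?g (tr ?e x))"
      by (rule integral_tr[symmetric, OF unit_vec_in_C]) measurable
    also have "\<dots> = (LINT x|\<mu>. ?g ?e * ?g x)"
      by (intro Bochner_Integration.integral_cong) (simp_all add: vilenkin_tr)
    finally show ?thesis by simp
  qed
  ultimately show ?thesis using False by simp
qed

text \<open>The function \<open>D (M n)\<close> is \<open>M n\<close> times the indicator of this
  cylinder, and by orthonormality only \<open>\<psi> 0\<close> contributes to its integral, which is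
  1.\<close>

lemma emeasure_cylinder_0: "emeasure \<mu> (cylinder m n (\<lambda>_. 0)) = ennreal (1 / real (M n))"
proof -
  let ?I = "cylinder m n (\<lambda>_. 0)"
  have int: "integrable \<mu> (\<psi> k)" for k
    by (rule integrable_const_bound[of _ 1]) auto
  have "?I \<inter> space \<mu> = ?I" by (auto simp: cylinder_def)
  then have "complex_of_real (real (M n) * measure \<mu> ?I) = (LINT x|\<mu>. of_nat (M n) * complex_of_real (indicator ?I x))"
    by simp
  also have "\<dots> = (LINT x|\<mu>. D (M n) x)"
    by (intro Bochner_Integration.integral_cong) (auto simp: dirichlet_M cylinder_def indicator_def)
  also have "\<dots> = (\<Sum>k<M n. LINT x|\<mu>. \<psi> k x)"
    unfolding dirichlet_def using int by (intro Bochner_Integration.integral_sum) auto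
  also have "\<dots> = (\<Sum>k<M n. if k = 0 then 1 else 0)"
    using integral_vilenkin_orthonormal[of _ 0] by (intro sum.cong) auto
  also have "\<dots> = 1" using M_pos[of n] by simp
  finally have "real (M n) * measure \<mu> ?I = 1"
    using of_real_eq_1_iff by blast
  then have "measure \<mu> ?I = 1 / real (M n)"
    using M_pos[of n] by (simp add: field_simps)
  then show ?thesis by (simp add: emeasure_eq_measure)
qed

text \<open>The gap set contains a translate of the cylinder of rank \<open>t + 2\<close> around 0,
  namely the one whose coordinates \<open>t\<close> and \<open>t + 1\<close> are 1.\<close>

lemma emeasure_gap_set: "ennreal (1 / real (M (t + 2))) \<le> emeasure \<mu> (gap_set t)"
proof -
  let ?a = "tr (unit_vec t) (unit_vec (Suc t))"
  let ?I = "cylinder m (t + 2) (\<lambda>_. 0)"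
  have "tr ?a ` ?I \<subseteq> gap_set t"
  proof
    fix y assume "y \<in> tr ?a ` ?I"
    then obtain x where x: "y = tr ?a x" "\<forall>j<t+2. x j = 0" by (auto simp: cylinder_def)
    have "y j = (unit_vec t j + unit_vec (Suc t) j) mod int (m j)" if "j < t + 2" for j
      using x that by (simp add: tr_eq)
    moreover have "1 mod int (m j) = 1" for j
      using m_ge2[of j] by simp
    ultimately show "y \<in> gap_set t"
      unfolding gap_set_def using tr_closed x(1) by (simp add: unit_vec_def)
  qed
  then have "emeasure \<mu> (tr ?a ` ?I) \<le> emeasure \<mu> (gap_set t)"
    by (rule emeasure_mono) measurable
  then show ?thesis
    by (simp add: emeasure_tr_image tr_closed emeasure_cylinder_0)
qed

section \<open>Martingales with prescribed Fourier coefficients\<close>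

definition coeff_mart :: "(nat \<Rightarrow> complex) \<Rightarrow> nat \<Rightarrow> (nat \<Rightarrow> int) \<Rightarrow> complex" where
  "coeff_mart c n x = (\<Sum>j<M n. c j * \<psi> j x)"

lemma fourier_coeff_coeff_mart:
  "fourier_coeff m \<mu> (coeff_mart c n) i = (if i < M n then c i else 0)"
proof -
  have int: "integrable \<mu> (\<lambda>x. c j * (\<psi> j x * cnj (\<psi> i x)))" for j
    by (rule integrable_const_bound[of _ "norm (c j)"]) (auto simp: norm_mult)
  have "fourier_coeff m \<mu> (coeff_mart c n) i = (LINT x|\<mu>. (\<Sum>j<M n. c j * (\<psi> j x * cnj (\<psi> i x))))"
    by (simp add: fourier_coeff_def coeff_mart_def sum_distrib_right mult.assoc)
  also have "\<dots> = (\<Sum>j<M n. LINT x|\<mu>. c j * (\<psi> j x * cnj (\<psi> i x)))"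
    using int by (intro Bochner_Integration.integral_sum) auto
  also have "\<dots> = (\<Sum>j<M n. if j = i then c j else 0)"
    by (intro sum.cong) (auto simp: integral_vilenkin_orthonormal)
  finally show ?thesis by simp
qed

lemma coeff_mart_martingale: "vilenkin_martingale m \<mu> (coeff_mart c)"
  unfolding vilenkin_martingale_def
proof (intro conjI allI impI ballI)
  fix n
  show meas: "coeff_mart c n \<in> borel_measurable (filtration m n)"
  proof -
    have "(\<lambda>x. \<Sum>j<M n. c j * \<psi> j x) \<in> borel_measurable (filtration m n)"
      by (intro borel_measurable_sum borel_measurable_times borel_measurable_const vilenkin_filtration) simp
    then show ?thesis by (simp add: coeff_mart_def[abs_def])
  qed
  have "norm (coeff_mart c n x) \<le> (\<Sum>j<M n. norm (c j))" for x
    unfolding coeff_mart_def by (rule sum_norm_le) (simp add: norm_mult)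
  then show "integrable \<mu> (coeff_mart c n)"
    by (intro integrable_const_bound[of _ "\<Sum>j<M n. norm (c j)"] borel_measurable_filtrationD[OF meas]) auto
next
  fix n k :: nat and x assume "n \<le> k"
  then have "j < M n \<Longrightarrow> j < M k" for j using M_mono[of n k] by simp
  then show "partial_sum m \<mu> (M n) (coeff_mart c k) x = coeff_mart c n x"
    unfolding partial_sum_def fourier_coeff_coeff_mart coeff_mart_def
    by (intro sum.cong) auto
qed

lemma mart_fourier_coeff_coeff_mart: "mart_fourier_coeff m \<mu> (coeff_mart c) i = c i"
  unfolding mart_fourier_coeff_def
proof (rule limI, rule tendsto_eventually)
  show "\<forall>\<^sub>F k in sequentially. fourier_coeff m \<mu> (coeff_mart c k) i = c i"
    using eventually_ge_at_top[of i]
  proof eventually_elim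
    case (elim k)
    then show ?case using less_M[of k] by (simp add: fourier_coeff_coeff_mart)
  qed
qed

end

section \<open>Lacunary martingales\<close>

lemma ennreal_powr_ennreal [simp]: "0 \<le> r \<Longrightarrow> ennreal_powr (ennreal r) p = ennreal (r powr p)"
  by (simp add: ennreal_powr_def)

text \<open>For finite \<open>S\<close> the bound is moved to \<open>g n\<close> by taking the root
  of order \<open>p\<close>, passed to the supremum there, and raised back.\<close>

lemma ennreal_powr_SUP_le:
  fixes g :: "nat \<Rightarrow> real"
  assumes "0 < p" and g0: "\<And>n. 0 \<le> g n" and le: "\<And>n. ennreal (g n powr p) \<le> S"
  shows "ennreal_powr (SUP n. ennreal (g n)) p \<le> S"
proof (cases S)
  case (real s)
  have "g n \<le> s powr (1 / p)" for n
  proof -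
    have "g n powr p \<le> s" using le[of n] real by (simp add: ennreal_le_iff)
    then have "(g n powr p) powr (1 / p) \<le> s powr (1 / p)"
      using \<open>0 < p\<close> by (intro powr_mono2) auto
    then show ?thesis using \<open>0 < p\<close> g0[of n] by (simp add: powr_powr)
  qed
  then have sup: "(SUP n. ennreal (g n)) \<le> ennreal (s powr (1 / p))"
    by (intro SUP_least ennreal_leI)
  then obtain t where t: "(SUP n. ennreal (g n)) = ennreal t" "0 \<le> t"
    by (cases "SUP n. ennreal (g n)") (auto simp: top_unique)
  have "t powr p \<le> (s powr (1 / p)) powr p"
    using sup t \<open>0 < p\<close> by (intro powr_mono2) (auto simp: ennreal_le_iff)
  also have "\<dots> = s" using \<open>0 < p\<close> real by (simp add: powr_powr)
  finally show ?thesis using t real by (simp add: ennreal_leI)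
qed simp

text \<open>A ratio in [0, 1] is at most its power of exponent \<open>p \<le> 1\<close>; this is
  applied to the shares of \<open>a\<close> and \<open>b\<close> in \<open>a + b\<close>, which add
  up to 1.\<close>

lemma powr_add_le:
  fixes a b p :: real
  assumes "0 \<le> a" "0 \<le> b" "0 < p" "p \<le> 1"
  shows "(a + b) powr p \<le> a powr p + b powr p"
proof (cases "a + b = 0")
  case True
  then show ?thesis using assms by simp
next
  case False
  then have s: "0 < a + b" using assms by linarith
  have *: "(a + b) powr p * (u / (a + b)) \<le> u powr p" if "0 \<le> u" "u \<le> a + b" for u
  proof -
    have "(u / (a + b)) powr 1 \<le> (u / (a + b)) powr p"
      using that s assms by (intro powr_mono') auto
    then have "u / (a + b) \<le> u powr p / (a + b) powr p"
      using that s by (simp add: powr_divide)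
    then show ?thesis using s by (simp add: field_simps)
  qed
  have "(a + b) powr p = (a + b) powr p * (a / (a + b)) + (a + b) powr p * (b / (a + b))"
    using s by (simp flip: distrib_left add_divide_distrib)
  also have "\<dots> \<le> a powr p + b powr p"
    using assms by (intro add_mono *) auto
  finally show ?thesis .
qed

text \<open>Normalized so that, for \<open>M_seq m a > 0\<close> and \<open>p > 0\<close>, the power
  with exponent \<open>p\<close> of \<open>block_coeff m p k a * M_seq m a\<close> is
  \<open>(1/2)^k * M_seq m a\<close>. Over a cylinder of rank \<open>a\<close> this integrates to
  \<open>(1/2)^k\<close>.\<close>

definition block_coeff :: "(nat \<Rightarrow> nat) \<Rightarrow> real \<Rightarrow> nat \<Rightarrow> nat \<Rightarrow> real" where
  "block_coeff m p k a = ((1/2) ^ k * real (M_seq m a)) powr (1 / p) / real (M_seq m a)"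

text \<open>The sum encodes a case distinction: for strictly increasing \<alpha> at most one term is
  nonzero. Summing over \<open>k \<le> j\<close> loses no block, since a block containing
  \<open>j\<close> has \<open>k \<le> \<alpha> k < M_seq m (\<alpha> k) \<le> j\<close>.\<close>

definition lacunary_coeff :: "(nat \<Rightarrow> nat) \<Rightarrow> real \<Rightarrow> (nat \<Rightarrow> nat) \<Rightarrow> nat \<Rightarrow> complex" where
  "lacunary_coeff m p \<alpha> j =
     (\<Sum>k\<le>j. if M_seq m (\<alpha> k) \<le> j \<and> j < M_seq m (Suc (\<alpha> k))
              then of_real (block_coeff m p k (\<alpha> k)) else 0)"

lemma block_coeff_nonneg: "0 \<le> block_coeff m p k a"
  by (simp add: block_coeff_def)

section \<open>Size of the lacunary coefficients\<close>

context vilenkin_system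
begin

lemma M_interval_unique:
  assumes "M a \<le> j" "j < M (Suc a)" "M b \<le> j" "j < M (Suc b)" shows "a = b"
proof (rule ccontr)
  assume "a \<noteq> b"
  then consider "Suc a \<le> b" | "Suc b \<le> a" by linarith
  then show False
  proof cases
    case 1
    then show False using assms M_mono[OF 1] by linarith
  next
    case 2
    then show False using assms M_mono[OF 2] by linarith
  qed
qed

lemma lacunary_coeff_block:
  assumes "strict_mono \<alpha>" "M (\<alpha> k) \<le> j" "j < M (Suc (\<alpha> k))"
  shows "lacunary_coeff m p \<alpha> j = of_real (block_coeff m p k (\<alpha> k))"
proof -
  have "k \<le> j"
    using strict_mono_imp_increasing[OF assms(1), of k] less_M[of "\<alpha> k"] assms(2) by linarith
  have "lacunary_coeff m p \<alpha> j = (\<Sum>i\<le>j. if i = k then of_real (block_coeff m p k (\<alpha> k)) else 0)"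
    unfolding lacunary_coeff_def
  proof (rule sum.cong)
    fix i
    have "i = k" if "M (\<alpha> i) \<le> j" "j < M (Suc (\<alpha> i))"
      using M_interval_unique[OF that assms(2,3)] strict_mono_eq[OF assms(1)] by blast
    then have "(M (\<alpha> i) \<le> j \<and> j < M (Suc (\<alpha> i))) \<longleftrightarrow> i = k" using assms(2,3) by blast
    then show "(if M (\<alpha> i) \<le> j \<and> j < M (Suc (\<alpha> i)) then of_real (block_coeff m p i (\<alpha> i)) else 0) =
      (if i = k then complex_of_real (block_coeff m p k (\<alpha> k)) else 0)" by simp
  qed simp
  then show ?thesis using \<open>k \<le> j\<close> by simp
qed

lemma lacunary_coeff_gap:
  assumes "a \<notin> range \<alpha>" "M a \<le> j" "j < M (Suc a)"
  shows "lacunary_coeff m p \<alpha> j = 0"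
  unfolding lacunary_coeff_def
proof (intro sum.neutral ballI if_not_P notI)
  fix k assume "M (\<alpha> k) \<le> j \<and> j < M (Suc (\<alpha> k))"
  then have "\<alpha> k = a" using M_interval_unique[OF _ _ assms(2,3)] by blast
  with assms(1) show False by blast
qed

text \<open>Every block starts at 1 or later. As \<open>M 0 = 1\<close>, the index 0 is all that the
  inductions on \<open>n\<close> over sums below \<open>M n\<close> have to treat at the
  start.\<close>

lemma lacunary_coeff_0: "lacunary_coeff m p \<alpha> 0 = 0"
  by (simp add: lacunary_coeff_def M_pos[THEN gr_implies_not0])

lemma sum_below_M_Suc:
  fixes h :: "nat \<Rightarrow> 'a::comm_monoid_add"
  shows "(\<Sum>j<M (Suc n). h j) = (\<Sum>j<M n. h j) + (\<Sum>j=M n..<M (Suc n). h j)"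
proof -
  have "{..<M (Suc n)} = {..<M n} \<union> {M n..<M (Suc n)}" using M_less_Suc[of n] by auto
  then show ?thesis by (simp add: sum.union_disjoint ivl_disj_int)
qed

text \<open>The set \<open>{k. \<alpha> k < n}\<close> lists the blocks lying below
  \<open>M n\<close>; each step of \<open>n\<close> adds at most one.\<close>

lemma strict_mono_less_Suc:
  fixes \<alpha> :: "nat \<Rightarrow> nat"
  assumes "strict_mono \<alpha>"
  shows "finite {k. \<alpha> k < n}"
    and "n \<notin> range \<alpha> \<Longrightarrow> {k. \<alpha> k < Suc n} = {k. \<alpha> k < n}"
    and "n = \<alpha> i \<Longrightarrow> {k. \<alpha> k < Suc n} = insert i {k. \<alpha> k < n}"
proof -
  have "{k. \<alpha> k < n} \<subseteq> {..<n}"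
    using strict_mono_imp_increasing[OF assms] by (auto intro: le_less_trans)
  then show "finite {k. \<alpha> k < n}" by (rule finite_subset) simp
  show "n \<notin> range \<alpha> \<Longrightarrow> {k. \<alpha> k < Suc n} = {k. \<alpha> k < n}"
    using less_Suc_eq by auto
  show "n = \<alpha> i \<Longrightarrow> {k. \<alpha> k < Suc n} = insert i {k. \<alpha> k < n}"
    using strict_mono_eq[OF assms] by (auto simp: less_Suc_eq)
qed

text \<open>A block of index \<open>i\<close> has fewer than \<open>M (Suc (\<alpha> i))\<close>
  elements. The bound involves only blocks before the \<open>k\<close>-th, so it is known when
  \<open>\<alpha> k\<close> is chosen.\<close>

lemma sum_norm_lacunary_coeff_le:
  assumes \<alpha>: "strict_mono \<alpha>"
  shows "(\<Sum>j<M (\<alpha> k). norm (lacunary_coeff m p \<alpha> j)) \<le>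
    (\<Sum>i<k. block_coeff m p i (\<alpha> i) * real (M (Suc (\<alpha> i))))"
proof -
  let ?c = "lacunary_coeff m p \<alpha>"
  have "(\<Sum>j<M n. norm (?c j)) \<le> (\<Sum>i | \<alpha> i < n. block_coeff m p i (\<alpha> i) * real (M (Suc (\<alpha> i))))" for n
  proof (induction n)
    case 0
    show ?case by (simp add: M_seq_rec lacunary_coeff_0)
  next
    case (Suc n)
    show ?case
    proof (cases "n \<in> range \<alpha>")
      case False
      then have "(\<Sum>j=M n..<M (Suc n). norm (?c j)) = 0"
        by (intro sum.neutral) (auto simp: lacunary_coeff_gap)
      then show ?thesis using Suc strict_mono_less_Suc(2)[OF \<alpha> False] by (simp add: sum_below_M_Suc)
    next
      case True
      then obtain i where i: "n = \<alpha> i" by blast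
      have "(\<Sum>j=M n..<M (Suc n). norm (?c j)) = (\<Sum>j=M n..<M (Suc n). block_coeff m p i (\<alpha> i))"
        unfolding i by (intro sum.cong) (auto simp: lacunary_coeff_block[OF \<alpha>] block_coeff_nonneg)
      also have "\<dots> = block_coeff m p i (\<alpha> i) * real (M (Suc n) - M n)" by simp
      also have "\<dots> \<le> block_coeff m p i (\<alpha> i) * real (M (Suc n))"
        by (intro mult_left_mono block_coeff_nonneg) simp
      finally show ?thesis
        using Suc strict_mono_less_Suc(1)[OF \<alpha>, of n] strict_mono_less_Suc(3)[OF \<alpha> i]
        unfolding sum_below_M_Suc by (simp add: i)
    qed
  qed
  from this[of "\<alpha> k"] show ?thesis
    using strict_mono_less[OF \<alpha>] by (simp add: lessThan_def)
qed

end

section \<open>Membership in the Hardy space\<close>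

locale bounded_vilenkin_haar = vilenkin_haar +
  fixes B :: nat
  assumes m_le: "m k \<le> B"
begin

lemma M_Suc_le: "real (M (Suc k)) \<le> real B * real (M k)"
  using mult_right_mono[of "real (m k)" "real B" "real (M k)"] m_le[of k] by (simp add: M_seq_rec)

text \<open>A block adds a multiple of \<open>D (M (Suc n)) - D (M n)\<close>, which lives on a
  cylinder of rank \<open>n\<close>. Subadditivity of the power with exponent \<open>p\<close>
  separates the blocks.\<close>

lemma coeff_mart_lacunary_powr_le:
  assumes \<alpha>: "strict_mono \<alpha>" and p: "0 < p" "p \<le> 1" and x: "x \<in> C"
  shows "norm (coeff_mart (lacunary_coeff m p \<alpha>) n x) powr p \<le>
    (\<Sum>k | \<alpha> k < n. real B powr p * ((1/2) ^ k * real (M (\<alpha> k))) * indicator (cylinder m (\<alpha> k) (\<lambda>_. 0)) x)"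
proof (induction n)
  case 0
  show ?case by (simp add: coeff_mart_def M_seq_rec lacunary_coeff_0)
next
  case (Suc n)
  let ?c = "lacunary_coeff m p \<alpha>"
  let ?w = "\<lambda>k. real B powr p * ((1/2) ^ k * real (M (\<alpha> k))) * indicator (cylinder m (\<alpha> k) (\<lambda>_. 0)) x"
  have split: "coeff_mart ?c (Suc n) x = coeff_mart ?c n x + (\<Sum>j=M n..<M (Suc n). ?c j * \<psi> j x)"
    unfolding coeff_mart_def by (rule sum_below_M_Suc)
  show ?case
  proof (cases "n \<in> range \<alpha>")
    case False
    then have "(\<Sum>j=M n..<M (Suc n). ?c j * \<psi> j x) = 0"
      by (intro sum.neutral) (auto simp: lacunary_coeff_gap)
    then show ?thesis using Suc strict_mono_less_Suc(2)[OF \<alpha> False] by (simp add: split)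
  next
    case True
    then obtain i where i: "n = \<alpha> i" by blast
    let ?I = "indicator (cylinder m n (\<lambda>_. 0)) x :: real"
    let ?b = "block_coeff m p i n"
    have "(\<Sum>j=M n..<M (Suc n). ?c j * \<psi> j x) = of_real ?b * (\<Sum>j=M n..<M (Suc n). \<psi> j x)"
      unfolding sum_distrib_left i by (intro sum.cong) (auto simp: lacunary_coeff_block[OF \<alpha>])
    also have "(\<Sum>j=M n..<M (Suc n). \<psi> j x) = D (M (Suc n)) x - D (M n) x"
      unfolding dirichlet_def sum_below_M_Suc by simp
    finally have eq: "(\<Sum>j=M n..<M (Suc n). ?c j * \<psi> j x) = of_real ?b * (D (M (Suc n)) x - D (M n) x)" .
    \<comment> \<open>Off the cylinder both kernels vanish; on it the difference is
      \<open>M (Suc n) - M n\<close> or \<open>- M n\<close>.\<close>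
    have "norm (D (M (Suc n)) x - D (M n) x) \<le> real (M (Suc n)) * ?I"
    proof -
      have "real (M (Suc n)) - real (M n) = norm (complex_of_nat (M (Suc n)) - of_nat (M n))"
        using M_less_Suc[of n] by (metis less_imp_le norm_of_nat of_nat_diff)
      then have "norm (complex_of_nat (M (Suc n)) - of_nat (M n)) \<le> real (M (Suc n))"
        by linarith
      moreover have "M n \<le> M (Suc n)" using M_less_Suc[of n] by simp
      ultimately show ?thesis
        using x by (auto simp: dirichlet_M cylinder_def indicator_def less_Suc_eq)
    qed
    also have "\<dots> \<le> real B * real (M n) * ?I"
      by (intro mult_right_mono M_Suc_le) simp
    finally have "norm (\<Sum>j=M n..<M (Suc n). ?c j * \<psi> j x) \<le> ?b * (real B * real (M n) * ?I)"
      unfolding eq norm_mult norm_of_real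
      using block_coeff_nonneg[of m p i n] by (intro mult_mono) auto
    also have "\<dots> = real B * ((1/2) ^ i * real (M n)) powr (1 / p) * ?I"
      using M_pos[of n] by (simp add: block_coeff_def)
    finally have "norm (\<Sum>j=M n..<M (Suc n). ?c j * \<psi> j x) powr p \<le>
        (real B * ((1/2) ^ i * real (M n)) powr (1 / p) * ?I) powr p"
      using p by (intro powr_mono2) auto
    also have "\<dots> = real B powr p * ((1/2) ^ i * real (M n)) * ?I"
      using p by (simp add: powr_mult powr_powr indicator_def)
    finally have new: "norm (\<Sum>j=M n..<M (Suc n). ?c j * \<psi> j x) powr p \<le> \<dots>" .
    have "norm (coeff_mart ?c (Suc n) x) powr p \<le>
        (norm (coeff_mart ?c n x) + norm (\<Sum>j=M n..<M (Suc n). ?c j * \<psi> j x)) powr p"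
      unfolding split using p by (intro powr_mono2 norm_triangle_ineq) auto
    also have "\<dots> \<le> norm (coeff_mart ?c n x) powr p + norm (\<Sum>j=M n..<M (Suc n). ?c j * \<psi> j x) powr p"
      using p by (intro powr_add_le) auto
    finally have "norm (coeff_mart ?c (Suc n) x) powr p \<le> (\<Sum>k | \<alpha> k < n. ?w k) + ?w i"
      using Suc new unfolding i[symmetric] by linarith
    also have "\<dots> = (\<Sum>k\<in>insert i {k. \<alpha> k < n}. ?w k)"
      using strict_mono_less_Suc(1)[OF \<alpha>, of n] by (subst sum.insert) (simp_all add: i)
    finally show ?thesis unfolding strict_mono_less_Suc(3)[OF \<alpha> i] .
  qed
qed

text \<open>Extending the pointwise bound to all \<open>k\<close> gives a majorant independent of
  \<open>n\<close>, hence one for the maximal function. Its integral is a geometric series because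
  each cylinder measure cancels \<open>M (\<alpha> k)\<close>.\<close>

lemma coeff_mart_lacunary_hardy:
  assumes \<alpha>: "strict_mono \<alpha>" and p: "0 < p" "p \<le> 1"
  shows "coeff_mart (lacunary_coeff m p \<alpha>) \<in> hardy_space m \<mu> p"
proof -
  let ?f = "coeff_mart (lacunary_coeff m p \<alpha>)"
  let ?g = "\<lambda>k x. ennreal (real B powr p * ((1/2) ^ k * real (M (\<alpha> k)))) * indicator (cylinder m (\<alpha> k) (\<lambda>_. 0)) x"
  have "ennreal_powr (maximal_function ?f x) p \<le> (\<Sum>k. ?g k x)" if x: "x \<in> space \<mu>" for x
    unfolding maximal_function_def
  proof (rule ennreal_powr_SUP_le)
    fix n
    have "ennreal (norm (?f n x) powr p) \<le> ennreal (\<Sum>k | \<alpha> k < n.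
        real B powr p * ((1/2) ^ k * real (M (\<alpha> k))) * indicator (cylinder m (\<alpha> k) (\<lambda>_. 0)) x)"
      using x by (intro ennreal_leI coeff_mart_lacunary_powr_le[OF \<alpha> p]) simp
    also have "\<dots> = (\<Sum>k | \<alpha> k < n. ?g k x)"
      by (subst sum_ennreal[symmetric]) (auto simp: ennreal_mult' ennreal_indicator intro!: sum.cong)
    also have "\<dots> \<le> (\<Sum>k. ?g k x)"
      using strict_mono_less_Suc(1)[OF \<alpha>] by (intro sum_le_suminf) auto
    finally show "ennreal (norm (?f n x) powr p) \<le> (\<Sum>k. ?g k x)" .
  qed (use p in auto)
  then have "(\<integral>\<^sup>+ x. ennreal_powr (maximal_function ?f x) p \<partial>\<mu>) \<le> (\<integral>\<^sup>+ x. (\<Sum>k. ?g k x) \<partial>\<mu>)"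
    by (rule nn_integral_mono)
  also have "\<dots> = (\<Sum>k. \<integral>\<^sup>+ x. ?g k x \<partial>\<mu>)"
    by (rule nn_integral_suminf) measurable
  also have "\<dots> = (\<Sum>k. ennreal (real B powr p * (1/2) ^ k))"
  proof (rule suminf_cong)
    fix k
    have "(\<integral>\<^sup>+ x. ?g k x \<partial>\<mu>) = ennreal (real B powr p * ((1/2) ^ k * real (M (\<alpha> k)))) * ennreal (1 / real (M (\<alpha> k)))"
      by (simp add: nn_integral_cmult_indicator emeasure_cylinder_0)
    also have "\<dots> = ennreal (real B powr p * (1/2) ^ k)"
      using M_pos[of "\<alpha> k"] by (simp add: ennreal_mult'[symmetric])
    finally show "(\<integral>\<^sup>+ x. ?g k x \<partial>\<mu>) = ennreal (real B powr p * (1/2) ^ k)" .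
  qed
  also have "\<dots> < \<top>"
  proof -
    have "summable (\<lambda>k. real B powr p * (1/2) ^ k)"
      by (intro summable_mult summable_geometric) simp
    then show ?thesis by (subst suminf_ennreal2) auto
  qed
  finally have fin: "(\<integral>\<^sup>+ x. ennreal_powr (maximal_function ?f x) p \<partial>\<mu>) < \<top>" .
  then have "Lp_quasinorm \<mu> p (maximal_function ?f) < \<top>"
    by (simp add: Lp_quasinorm_def ennreal_powr_def)
  then show ?thesis by (simp add: hardy_space_def coeff_mart_martingale)
qed

section \<open>Fejer means of lacunary martingales\<close>

lemma fejer_mean_coeff_mart:
  "fejer_mean m \<mu> n (coeff_mart c) x = (\<Sum>j=1..n. \<Sum>i<j. c i * \<psi> i x) / of_nat n"
  by (simp add: fejer_mean_def mart_partial_sum_def mart_fourier_coeff_coeff_mart)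

lemma fejer_mean_measurable [measurable]: "fejer_mean m \<mu> n (coeff_mart c) \<in> borel_measurable \<mu>"
  unfolding fejer_mean_coeff_mart[abs_def] by measurable

text \<open>Partial sums up to \<open>M (\<alpha> k)\<close> are bounded by \<open>L\<close>. A
  later one is the partial sum at \<open>M (\<alpha> k)\<close> plus a multiple of
  \<open>D t\<close>, so the sum of all \<open>n\<close> of them is a multiple of \<open>F s\<close>
  up to an error of at most \<open>n * L\<close>.\<close>

lemma fejer_mean_lacunary_ge:
  assumes \<alpha>: "strict_mono \<alpha>" and s: "s \<le> M (\<alpha> k)"
    and L: "L = (\<Sum>i<k. block_coeff m p i (\<alpha> i) * real (M (Suc (\<alpha> i))))"
    and n: "n = M (\<alpha> k) + s"
  shows "block_coeff m p k (\<alpha> k) * norm (F s x) \<le>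
    real n * (norm (fejer_mean m \<mu> n (coeff_mart (lacunary_coeff m p \<alpha>)) x) + L)"
proof -
  let ?c = "lacunary_coeff m p \<alpha>"
  let ?a = "\<alpha> k"
  let ?b = "block_coeff m p k ?a"
  define S where "S j = (\<Sum>i<j. ?c i * \<psi> i x)" for j
  have low: "norm (S j) \<le> L" if "j \<le> M ?a" for j
  proof -
    have "norm (S j) \<le> (\<Sum>i<j. norm (?c i))"
      unfolding S_def by (rule sum_norm_le) (simp add: norm_mult)
    also have "\<dots> \<le> (\<Sum>i<M ?a. norm (?c i))"
      using that by (intro sum_mono2) auto
    also have "\<dots> \<le> L" unfolding L by (rule sum_norm_lacunary_coeff_le[OF \<alpha>])
    finally show ?thesis .
  qed
  \<comment> \<open>The indices involved stay in the first run of length \<open>M ?a\<close> of the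
    block, where the digit of index \<open>?a\<close> is 1.\<close>
  have S_block: "S (M ?a + t) = S (M ?a) + of_real ?b * r ?a x * D t x" if "t \<le> M ?a" for t
    using that
  proof (induction t)
    case (Suc t)
    have "1 < m ?a" using m_ge2[of ?a] by linarith
    then have "\<psi> (M ?a + t) x = r ?a x * \<psi> t x"
      using vilenkin_block[of 1 ?a t x] Suc.prems by simp
    moreover have "M ?a + t < M (Suc ?a)"
      using block_less[of 1 ?a t] \<open>1 < m ?a\<close> Suc.prems by simp
    then have "?c (M ?a + t) = of_real ?b" by (intro lacunary_coeff_block[OF \<alpha>]) auto
    moreover have "S (M ?a + Suc t) = S (M ?a + t) + ?c (M ?a + t) * \<psi> (M ?a + t) x"
      by (simp add: S_def)
    ultimately show ?case using Suc by (simp add: dirichlet_def algebra_simps)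
  qed simp
  have "norm ((\<Sum>j=1..M ?a + t. S j) - of_real ?b * r ?a x * F t x) \<le> real (M ?a + t) * L"
    if "t \<le> M ?a" for t
    using that
  proof (induction t)
    case 0
    have "norm (\<Sum>j=1..M ?a. S j) \<le> (\<Sum>j=1..M ?a. L)"
      by (rule sum_norm_le) (simp add: low)
    then show ?case by simp
  next
    case (Suc t)
    have "(\<Sum>j=1..M ?a + Suc t. S j) - of_real ?b * r ?a x * F (Suc t) x =
      ((\<Sum>j=1..M ?a + t. S j) - of_real ?b * r ?a x * F t x) + S (M ?a)"
      using S_block[OF Suc.prems] by (simp add: algebra_simps)
    also have "norm \<dots> \<le> real (M ?a + t) * L + L"
      using Suc low[of "M ?a"] by (intro norm_triangle_mono) auto
    finally show ?case by (simp add: algebra_simps)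
  qed
  from this[OF s] have "norm (of_real ?b * r ?a x * F s x) \<le> norm (\<Sum>j=1..n. S j) + real n * L"
    using norm_triangle_ineq2[of "of_real ?b * r ?a x * F s x" "\<Sum>j=1..n. S j"]
    unfolding n[symmetric] norm_minus_commute[of "\<Sum>j=1..n. S j"] by linarith
  moreover have "norm (of_real ?b * r ?a x * F s x) = ?b * norm (F s x)"
    using block_coeff_nonneg by (simp add: norm_mult)
  moreover have "0 < n" using n M_pos[of ?a] by simp
  then have "norm (\<Sum>j=1..n. S j) = real n * norm (fejer_mean m \<mu> n (coeff_mart ?c) x)"
    by (simp add: fejer_mean_coeff_mart S_def norm_divide)
  ultimately show ?thesis by (simp add: distrib_left)
qed

text \<open>The requirement on \<open>\<alpha> k\<close> refers to the earlier values only through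
  one accumulated sum, so a recursion can carry that sum along; the freedom in \<open>N\<close>
  makes \<alpha> strictly increasing.\<close>

lemma lacunary_choice:
  assumes ex: "\<And>k L N. 0 \<le> L \<Longrightarrow> \<exists>a\<ge>N. Good k L a"
  shows "\<exists>\<alpha>. strict_mono \<alpha> \<and>
    (\<forall>k. Good k (\<Sum>i<k. block_coeff m p i (\<alpha> i) * real (M (Suc (\<alpha> i)))) (\<alpha> k))"
proof -
  let ?w = "\<lambda>k a. block_coeff m p k a * real (M (Suc a))"
  \<comment> \<open>The first component of \<open>h k\<close> is the value of \<alpha>, the second
    the accumulated sum, which starts as the empty sum and must stay nonnegative for
    \<open>ex\<close> to apply.\<close>
  have "\<exists>h. \<forall>k. (0 \<le> snd (h k) \<and> Good k (snd (h k)) (fst (h k)) \<and> (k = 0 \<longrightarrow> snd (h k) = 0)) \<and>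
     (fst (h k) < fst (h (Suc k)) \<and> snd (h (Suc k)) = snd (h k) + ?w k (fst (h k)))"
  proof (rule dependent_nat_choice, goal_cases)
    case 1
    obtain a where "Good 0 0 a" using ex[of 0 0 0] by blast
    then show ?case by (intro exI[of _ "(a, 0)"]) simp
  next
    case (2 h k)
    then have "0 \<le> snd h + ?w k (fst h)" using block_coeff_nonneg by simp
    then obtain a where "Suc (fst h) \<le> a" "Good (Suc k) (snd h + ?w k (fst h)) a" using ex by blast
    then show ?case
      using \<open>0 \<le> snd h + ?w k (fst h)\<close> by (intro exI[of _ "(a, snd h + ?w k (fst h))"]) simp
  qed
  then obtain h where h: "\<And>k. Good k (snd (h k)) (fst (h k))" "snd (h 0) = 0"
    "\<And>k. fst (h k) < fst (h (Suc k))" "\<And>k. snd (h (Suc k)) = snd (h k) + ?w k (fst (h k))"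
    by blast
  have "snd (h k) = (\<Sum>i<k. ?w i (fst (h i)))" for k
    by (induction k) (simp_all add: h)
  moreover have "strict_mono (\<lambda>k. fst (h k))" by (simp add: strict_mono_Suc_iff h)
  ultimately show ?thesis using h(1) by (intro exI[of _ "\<lambda>k. fst (h k)"]) auto
qed

text \<open>The gap sets are disjoint, and each contributes an amount independent of
  \<open>i\<close>: the integrand is at least \<open>M (2 * i) / sqrt 2\<close> on a set of measure
  at least \<open>1 / ((real B)^2 * M (2 * i))\<close>.\<close>

lemma nn_integral_fejer_sum_ge:
  "ennreal (real A / (sqrt 2 * (real B)\<^sup>2)) \<le> (\<integral>\<^sup>+ x. ennreal (sqrt (norm (F (even_sum A) x))) \<partial>\<mu>)"
proof -
  let ?g = "\<lambda>i x. ennreal (real (M (2 * i)) / sqrt 2) * indicator (gap_set (2 * i)) x"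
  have B: "0 < real B" using m_le[of 0] m_pos[of 0] by linarith
  have "ennreal (1 / (sqrt 2 * (real B)\<^sup>2)) \<le> (\<integral>\<^sup>+ x. ?g i x \<partial>\<mu>)" for i
  proof -
    have "real (M (2 * i + 2)) \<le> real B * (real B * real (M (2 * i)))"
      using M_Suc_le[of "Suc (2 * i)"] mult_left_mono[OF M_Suc_le[of "2 * i"], of "real B"] by simp
    then have "1 / (sqrt 2 * (real B)\<^sup>2) \<le> real (M (2 * i)) / sqrt 2 * (1 / real (M (2 * i + 2)))"
      using B M_pos[of "2 * i"] M_pos[of "2 * i + 2"] by (simp add: field_simps power2_eq_square)
    then have "ennreal (1 / (sqrt 2 * (real B)\<^sup>2)) \<le> ennreal (real (M (2 * i)) / sqrt 2) * ennreal (1 / real (M (2 * i + 2)))"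
      by (subst ennreal_mult'[symmetric]) (auto intro: ennreal_leI)
    also have "\<dots> \<le> ennreal (real (M (2 * i)) / sqrt 2) * emeasure \<mu> (gap_set (2 * i))"
      by (intro mult_left_mono emeasure_gap_set) simp
    also have "\<dots> = (\<integral>\<^sup>+ x. ?g i x \<partial>\<mu>)"
      by (simp add: nn_integral_cmult_indicator)
    finally show ?thesis .
  qed
  then have "(\<Sum>i<A. ennreal (1 / (sqrt 2 * (real B)\<^sup>2))) \<le> (\<Sum>i<A. \<integral>\<^sup>+ x. ?g i x \<partial>\<mu>)"
    by (intro sum_mono)
  also have "\<dots> = (\<integral>\<^sup>+ x. (\<Sum>i<A. ?g i x) \<partial>\<mu>)"
    by (rule nn_integral_sum[symmetric]) measurable
  also have "\<dots> \<le> (\<integral>\<^sup>+ x. ennreal (sqrt (norm (F (even_sum A) x))) \<partial>\<mu>)"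
  proof (rule nn_integral_mono)
    fix x
    show "(\<Sum>i<A. ?g i x) \<le> ennreal (sqrt (norm (F (even_sum A) x)))"
    proof (cases "\<exists>i<A. x \<in> gap_set (2 * i)")
      case True
      then obtain i where i: "i < A" "x \<in> gap_set (2 * i)" by blast
      have "(\<Sum>j<A. ?g j x) = (\<Sum>j<A. if j = i then ennreal (real (M (2 * i)) / sqrt 2) else 0)"
      proof (rule sum.cong)
        fix j
        have "x \<notin> gap_set (2 * j)" if "j \<noteq> i"
          using gap_set_disjoint[OF i(2), of "2 * j"] that by linarith
        then show "?g j x = (if j = i then ennreal (real (M (2 * i)) / sqrt 2) else 0)"
          using i(2) by simp
      qed simp
      also have "\<dots> = ennreal (real (M (2 * i)) / sqrt 2)" using i(1) by simp
      also have "real (M (2 * i)) / sqrt 2 = sqrt ((real (M (2 * i)))\<^sup>2 / 2)"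
        by (simp add: real_sqrt_divide)
      also have "ennreal \<dots> \<le> ennreal (sqrt (norm (F (even_sum A) x)))"
        using fejer_sum_even_sum_ge[OF i(2,1)] by (intro ennreal_leI real_sqrt_le_mono)
      finally show ?thesis .
    next
      case False
      then have "(\<Sum>i<A. ?g i x) = 0" by (intro sum.neutral) auto
      then show ?thesis by simp
    qed
  qed
  also have "(\<Sum>i<A. ennreal (1 / (sqrt 2 * (real B)\<^sup>2))) = ennreal (real A / (sqrt 2 * (real B)\<^sup>2))"
    by (subst sum_ennreal) auto
  finally show ?thesis .
qed

section \<open>Divergence at the exponent 1/2 and below it\<close>

lemma strong_divergence:
  "\<exists>f\<in>hardy_space m \<mu> (1/2).
     (SUP n\<in>{1..}. Lp_quasinorm \<mu> (1/2) (\<lambda>x. ennreal (norm (fejer_mean m \<mu> n f x)))) = \<top>"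
proof -
  \<comment> \<open>The factor \<open>sqrt 2 * 2 ^ k\<close> is the constant lost in
    \<open>pt\<close> below and \<open>sqrt L\<close> the loss from earlier blocks; what remains for
    the Fejer mean is \<open>Suc k\<close>.\<close>
  define Good where "Good k L a \<longleftrightarrow> (\<exists>s\<le>M a. ennreal (sqrt 2 * 2 ^ k * (real (Suc k) + sqrt L)) \<le>
      (\<integral>\<^sup>+ x. ennreal (sqrt (norm (F s x))) \<partial>\<mu>))" for k L a
  have "\<exists>a\<ge>N. Good k L a" if "0 \<le> L" for k L N
  proof -
    define K where "K = sqrt 2 * 2 ^ k * (real (Suc k) + sqrt L)"
    obtain A :: nat where A: "K * (sqrt 2 * (real B)\<^sup>2) \<le> real A" using real_arch_simple by blast
    have "0 < real B" using m_le[of 0] m_pos[of 0] by linarith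
    then have "K \<le> real A / (sqrt 2 * (real B)\<^sup>2)" using A by (simp add: field_simps)
    then have "ennreal K \<le> (\<integral>\<^sup>+ x. ennreal (sqrt (norm (F (even_sum A) x))) \<partial>\<mu>)"
      using nn_integral_fejer_sum_ge[of A] by (meson ennreal_leI order_trans)
    \<comment> \<open>The integral depends on \<open>A\<close> alone, so \<open>a\<close> may be
      enlarged freely to exceed \<open>N\<close>.\<close>
    moreover have "even_sum A \<le> M (max N (2 * A))"
      using even_sum_le[of A] M_mono[of "2 * A" "max N (2 * A)"] by simp
    ultimately have "Good k L (max N (2 * A))" unfolding Good_def K_def by blast
    then show ?thesis by (intro exI[of _ "max N (2 * A)"]) simp
  qed
  then obtain \<alpha> where \<alpha>: "strict_mono \<alpha>" and
    good: "\<And>k. Good k (\<Sum>i<k. block_coeff m (1/2) i (\<alpha> i) * real (M (Suc (\<alpha> i)))) (\<alpha> k)"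
    using lacunary_choice[of Good "1/2"] by blast
  let ?f = "coeff_mart (lacunary_coeff m (1/2) \<alpha>)"
  have "\<exists>n\<in>{1..}. of_nat k \<le> Lp_quasinorm \<mu> (1/2) (\<lambda>x. ennreal (norm (fejer_mean m \<mu> n ?f x)))" for k
  proof -
    define L where "L = (\<Sum>i<k. block_coeff m (1/2) i (\<alpha> i) * real (M (Suc (\<alpha> i))))"
    have L0: "0 \<le> L" unfolding L_def by (intro sum_nonneg mult_nonneg_nonneg block_coeff_nonneg) simp
    let ?N = "real (M (\<alpha> k))"
    obtain s where s: "s \<le> M (\<alpha> k)" "ennreal (sqrt 2 * 2 ^ k * (real (Suc k) + sqrt L)) \<le>
      (\<integral>\<^sup>+ x. ennreal (sqrt (norm (F s x))) \<partial>\<mu>)"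
      using good[of k] unfolding Good_def L_def by blast
    define n where "n = M (\<alpha> k) + s"
    let ?\<sigma> = "fejer_mean m \<mu> n ?f"
    let ?J = "\<integral>\<^sup>+ x. ennreal (sqrt (norm (?\<sigma> x))) \<partial>\<mu>"
    have N: "0 < ?N" using M_pos by simp
    have pt: "sqrt (norm (F s x)) \<le> sqrt 2 * 2 ^ k * (sqrt (norm (?\<sigma> x)) + sqrt L)" for x
    proof -
      have "((1/2) ^ k)\<^sup>2 = ((1/2)\<^sup>2 :: real) ^ k" by (simp only: power_mult[symmetric] mult.commute)
      also have "\<dots> = 1 / 4 ^ k" by (simp add: power2_eq_square power_one_over)
      finally have sq: "((1/2) ^ k)\<^sup>2 = (1 / 4 ^ k :: real)" .
      have "((1/2) ^ k * ?N) powr (1 / (1/2)) = ((1/2) ^ k * ?N)\<^sup>2" using N by (simp add: powr_numeral)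
      also have "\<dots> = ((1/2) ^ k)\<^sup>2 * ?N\<^sup>2" by (rule power_mult_distrib)
      also have "\<dots> = 1 / 4 ^ k * ?N * ?N" unfolding sq by (simp add: power2_eq_square)
      finally have "((1/2) ^ k * ?N) powr (1 / (1/2)) = 1 / 4 ^ k * ?N * ?N" .
      then have "block_coeff m (1/2) k (\<alpha> k) = ?N / 4 ^ k"
        using N by (simp add: block_coeff_def)
      then have "?N / 4 ^ k * norm (F s x) \<le> real n * (norm (?\<sigma> x) + L)"
        using fejer_mean_lacunary_ge[OF \<alpha> s(1) L_def n_def, of x] by simp
      \<comment> \<open>Here \<open>n = M (\<alpha> k) + s\<close> is at most twice
        \<open>M (\<alpha> k)\<close>.\<close>
      also have "\<dots> \<le> (2 * ?N) * (norm (?\<sigma> x) + L)"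
        using s(1) L0 by (intro mult_right_mono) (simp_all add: n_def)
      finally have "?N * norm (F s x) \<le> ?N * (2 * 4 ^ k * (norm (?\<sigma> x) + L))"
        by (simp add: field_simps)
      then have "norm (F s x) \<le> 2 * 4 ^ k * (norm (?\<sigma> x) + L)"
        using N by (simp only: mult_le_cancel_left_pos)
      then have "sqrt (norm (F s x)) \<le> sqrt (2 * 4 ^ k * (norm (?\<sigma> x) + L))"
        by (rule real_sqrt_le_mono)
      also have "\<dots> = sqrt 2 * 2 ^ k * sqrt (norm (?\<sigma> x) + L)"
        by (simp add: real_sqrt_mult real_sqrt_power)
      also have "\<dots> \<le> sqrt 2 * 2 ^ k * (sqrt (norm (?\<sigma> x)) + sqrt L)"
        using L0 by (intro mult_left_mono sqrt_add_le_add_sqrt) auto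
      finally show ?thesis .
    qed
    define c :: real where "c = sqrt 2 * 2 ^ k"
    have c: "0 < c" by (simp add: c_def)
    have "ennreal (c * (real (Suc k) + sqrt L)) \<le> (\<integral>\<^sup>+ x. ennreal (sqrt (norm (F s x))) \<partial>\<mu>)"
      using s(2) unfolding c_def .
    also have "\<dots> \<le> (\<integral>\<^sup>+ x. ennreal c * (ennreal (sqrt (norm (?\<sigma> x))) + ennreal (sqrt L)) \<partial>\<mu>)"
    proof (rule nn_integral_mono)
      fix x
      have "ennreal (sqrt (norm (F s x))) \<le> ennreal (c * (sqrt (norm (?\<sigma> x)) + sqrt L))"
        unfolding c_def by (rule ennreal_leI[OF pt])
      also have "\<dots> = ennreal c * (ennreal (sqrt (norm (?\<sigma> x))) + ennreal (sqrt L))"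
        using L0 c by (simp add: ennreal_mult' ennreal_plus)
      finally show "ennreal (sqrt (norm (F s x))) \<le> \<dots>" .
    qed
    also have "\<dots> = ennreal c * (\<integral>\<^sup>+ x. ennreal (sqrt (norm (?\<sigma> x))) + ennreal (sqrt L) \<partial>\<mu>)"
      by (rule nn_integral_cmult) measurable
    also have "(\<integral>\<^sup>+ x. ennreal (sqrt (norm (?\<sigma> x))) + ennreal (sqrt L) \<partial>\<mu>) = ?J + (\<integral>\<^sup>+ x. ennreal (sqrt L) \<partial>\<mu>)"
      by (rule nn_integral_add) measurable
    also have "(\<integral>\<^sup>+ x. ennreal (sqrt L) \<partial>\<mu>) = ennreal (sqrt L)"
      unfolding nn_integral_const emeasure_space_1 by (rule mult_1_right)
    finally have J: "ennreal (c * (real (Suc k) + sqrt L)) \<le> ennreal c * (?J + ennreal (sqrt L))" .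
    have "ennreal (real k) \<le> ennreal_powr ?J 2"
    proof (cases ?J)
      case (real j)
      have "ennreal c * (?J + ennreal (sqrt L)) = ennreal (c * (j + sqrt L))"
        unfolding real(2) using real(1) L0 c by (simp add: ennreal_mult' ennreal_plus)
      with J have "c * (real (Suc k) + sqrt L) \<le> c * (j + sqrt L)"
        using real(1) L0 c by (simp only: ennreal_le_iff mult_nonneg_nonneg add_nonneg_nonneg real_sqrt_ge_zero less_imp_le)
      \<comment> \<open>The threshold \<open>Suc k\<close> instead of \<open>k\<close> yields
        \<open>1 \<le> j\<close>, so that the square in the quasinorm does not spoil the
        bound.\<close>
      then have j: "real k \<le> j" "1 \<le> j" using c by simp_all
      have "real k \<le> j * 1" using j by simp
      also have "\<dots> \<le> j * j" using j by (intro mult_left_mono) auto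
      also have "\<dots> = j powr 2" using j by (simp add: powr_numeral power2_eq_square)
      finally have "ennreal (real k) \<le> ennreal (j powr 2)" by (rule ennreal_leI)
      then show ?thesis unfolding real(2) ennreal_powr_ennreal[OF real(1)] .
    next
      case top
      then show ?thesis unfolding top ennreal_powr_def by (simp only: simp_thms if_True top_greatest)
    qed
    moreover have "Lp_quasinorm \<mu> (1/2) (\<lambda>x. ennreal (norm (?\<sigma> x))) = ennreal_powr ?J 2"
      by (simp add: Lp_quasinorm_def powr_half_sqrt)
    moreover have "1 \<le> n" using M_pos[of "\<alpha> k"] by (simp add: n_def)
    ultimately show ?thesis by (intro bexI[of _ n]) (auto simp: ennreal_of_nat_eq_real_of_nat)
  qed
  then have "(SUP n\<in>{1..}. Lp_quasinorm \<mu> (1/2) (\<lambda>x. ennreal (norm (fejer_mean m \<mu> n ?f x)))) = \<top>"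
    by (rule ennreal_SUP_eq_top)
  then show ?thesis using coeff_mart_lacunary_hardy[OF \<alpha>, of "1/2"] by auto
qed

lemma weak_divergence:
  assumes p: "0 < p" "p < 1/2"
  shows "\<exists>f\<in>hardy_space m \<mu> p.
     (SUP n\<in>{1..}. weak_Lp_quasinorm \<mu> p (\<lambda>x. ennreal (norm (fejer_mean m \<mu> n f x)))) = \<top>"
proof -
  define Good where "Good k L a \<longleftrightarrow> real (M a + 1) * (real (Suc k) + L) < block_coeff m p k a" for k L a
  have "\<exists>a\<ge>N. Good k L a" if L: "0 \<le> L" for k L N
  proof -
    \<comment> \<open>This is the exponent with which \<open>block_coeff m p k a / M a\<close> grows
      in \<open>M a\<close>; it is positive exactly because \<open>p < 1/2\<close>.\<close>
    define e where "e = 1 / p - 2"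
    have e: "0 < e" using p by (simp add: e_def field_simps)
    \<comment> \<open>Obtained by solving the condition in \<open>Good\<close> for the power
      \<open>e\<close> of \<open>M a\<close>, with \<open>M a + 1\<close> replaced by
      \<open>2 * M a\<close>.\<close>
    define K where "K = 2 * (real (Suc k) + L) / ((1/2) ^ k) powr (1 / p)"
    have K: "0 < K" using L by (simp add: K_def)
    obtain a where a: "N \<le> a" "K powr (1 / e) \<le> real a"
      by (meson real_arch_simple max.bounded_iff of_nat_le_iff order_trans linear)
    define X where "X = real (M a)"
    have X: "1 \<le> X" using M_pos[of a] by (simp add: X_def)
    have "K powr (1 / e) < X" using a(2) less_M[of a] unfolding X_def by linarith
    then have "(K powr (1 / e)) powr e < X powr e" using e by (intro powr_less_mono2) auto
    then have "K < X powr e" using e K by (simp add: powr_powr)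
    then have "2 * (real (Suc k) + L) < ((1/2) ^ k) powr (1 / p) * X powr e"
      by (simp add: K_def field_simps)
    then have "X * (2 * (real (Suc k) + L)) < X * (((1/2) ^ k) powr (1 / p) * X powr e)"
      using X by (intro mult_strict_left_mono) auto
    also have "\<dots> = ((1/2) ^ k * X) powr (1 / p) / X"
      using X by (simp add: e_def powr_mult powr_diff power2_eq_square powr_numeral)
    finally have "X * (2 * (real (Suc k) + L)) < block_coeff m p k a"
      by (simp only: block_coeff_def X_def)
    moreover have "real (M a + 1) * (real (Suc k) + L) \<le> (2 * X) * (real (Suc k) + L)"
      using X L by (intro mult_right_mono) (auto simp: X_def)
    moreover have "(2 * X) * (real (Suc k) + L) = X * (2 * (real (Suc k) + L))"
      by (simp only: mult_ac)
    ultimately show ?thesis unfolding Good_def using a(1) by (intro exI[of _ a]) linarith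
  qed
  then obtain \<alpha> where \<alpha>: "strict_mono \<alpha>" and
    good: "\<And>k. Good k (\<Sum>i<k. block_coeff m p i (\<alpha> i) * real (M (Suc (\<alpha> i)))) (\<alpha> k)"
    using lacunary_choice[of Good p] by blast
  let ?f = "coeff_mart (lacunary_coeff m p \<alpha>)"
  have "\<exists>n\<in>{1..}. of_nat k \<le> weak_Lp_quasinorm \<mu> p (\<lambda>x. ennreal (norm (fejer_mean m \<mu> n ?f x)))" for k
  proof -
    define L where "L = (\<Sum>i<k. block_coeff m p i (\<alpha> i) * real (M (Suc (\<alpha> i))))"
    define n where "n = M (\<alpha> k) + 1"
    let ?g = "\<lambda>x. ennreal (norm (fejer_mean m \<mu> n ?f x))"
    \<comment> \<open>With \<open>s = 1\<close> the kernel sum is the constant 1, so the lower bound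
      holds at every point.\<close>
    have "real (Suc k) < norm (fejer_mean m \<mu> n ?f x)" for x
    proof -
      have "F 1 x = 1" by (simp add: fejer_sum_def dirichlet_def)
      then have "block_coeff m p k (\<alpha> k) \<le> real n * (norm (fejer_mean m \<mu> n ?f x) + L)"
        using fejer_mean_lacunary_ge[OF \<alpha> _ L_def n_def, of x] M_pos[of "\<alpha> k"] by simp
      moreover have "real n * (real (Suc k) + L) < block_coeff m p k (\<alpha> k)"
        using good[of k] unfolding Good_def L_def n_def .
      ultimately have "real n * (real (Suc k) + L) < real n * (norm (fejer_mean m \<mu> n ?f x) + L)"
        by linarith
      then show ?thesis by (simp add: n_def)
    qed
    \<comment> \<open>The level set has measure 1, so the level itself bounds the weak quasinorm
      from below. The level \<open>Suc k\<close> is positive even for \<open>k = 0\<close>.\<close>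
    then have "{x \<in> space \<mu>. ennreal (real (Suc k)) < ?g x} = space \<mu>"
      by (auto simp: ennreal_less_iff simp del: of_nat_Suc)
    then have "ennreal (real (Suc k)) * ennreal_powr (emeasure \<mu> {x \<in> space \<mu>. ennreal (real (Suc k)) < ?g x}) (1 / p)
        = ennreal (real (Suc k))"
      using ennreal_powr_ennreal[of 1 "1 / p"] by (simp only: emeasure_space_1) simp
    moreover have "ennreal (real (Suc k)) * ennreal_powr (emeasure \<mu> {x \<in> space \<mu>. ennreal (real (Suc k)) < ?g x}) (1 / p)
        \<le> weak_Lp_quasinorm \<mu> p ?g"
      unfolding weak_Lp_quasinorm_def by (rule SUP_upper) simp
    moreover have "of_nat k \<le> ennreal (real (Suc k))"
      unfolding ennreal_of_nat_eq_real_of_nat by (intro ennreal_leI) simp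
    ultimately have "of_nat k \<le> weak_Lp_quasinorm \<mu> p ?g" by simp
    moreover have "1 \<le> n" by (simp add: n_def)
    ultimately show ?thesis by (intro bexI[of _ n]) auto
  qed
  then have "(SUP n\<in>{1..}. weak_Lp_quasinorm \<mu> p (\<lambda>x. ennreal (norm (fejer_mean m \<mu> n ?f x)))) = \<top>"
    by (rule ennreal_SUP_eq_top)
  then show ?thesis using coeff_mart_lacunary_hardy[OF \<alpha>, of p] p by auto
qed

end

theorem theorem3p1:
  fixes m :: "nat \<Rightarrow> nat" and \<mu> :: "(nat \<Rightarrow> int) measure"
  assumes "\<And>k. 2 \<le> m k" and "bdd_above (range m)"
    and "normalized_haar (vilenkin_group m) (vilenkin_topology m) \<mu>"
  shows "(\<exists>f \<in> hardy_space m \<mu> (1/2).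
            (SUP n\<in>{1..}. Lp_quasinorm \<mu> (1/2) (\<lambda>x. ennreal (norm (fejer_mean m \<mu> n f x)))) = \<top>) \<and>
         (\<forall>p::real. 0 < p \<and> p < 1/2 \<longrightarrow>
            (\<exists>f \<in> hardy_space m \<mu> p.
               (SUP n\<in>{1..}. weak_Lp_quasinorm \<mu> p (\<lambda>x. ennreal (norm (fejer_mean m \<mu> n f x)))) = \<top>))"
proof -
  obtain B where "\<And>k. m k \<le> B" using assms(2) by (auto simp: bdd_above_def)
  then interpret bounded_vilenkin_haar m \<mu> B
    using assms by unfold_locales auto
  show ?thesis using strong_divergence weak_divergence by blast
qed

end
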